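(* Consider the finite-sum compositional problem of minimizing $\Phi(x)=f(g(x))$ under the finite-gap, smoothness, boundedness and bounded-variance assumptions, and the STORM-Compositional algorithm, all as described in the context. Pick $\eta=\frac{1}{L_\Phi}$ and, as functions of the desired precision $\varepsilon\to0^+$, $a_g,a_{\partial g},a_\Phi\sim\mathcal O(\varepsilon)$, $B_g,B_{\partial g},B_f,S_g,S_{\partial g},S_f\sim\mathcal O(\varepsilon^{-1})$ and $T\sim\mathcal O(\varepsilon^{-2})$. Then the output $\widehat x$ satisfies $\mathbf{E}\|\nabla\Phi(\widehat x)\|\lesssim\mathcal O(\varepsilon)$, and the total IFO complexity is $\lesssim\mathcal O(\varepsilon^{-3})$.
   Context: Asymptotic notation: $p\sim\mathcal O(q)$ means there are constants $0<c<C<\infty$ (independent of $\varepsilon$) with $cq\le p\le Cq$ for all sufficiently small $\varepsilon>0$; $p\lesssim\mathcal O(q)$ means only the upper bound $p\le Cq$ is required. The problem data ($f_i,g_j,x_0$ and all constants below) are fixed independently of $\varepsilon$. Norms: $\|\cdot\|$ is the Euclidean norm of vectors and the induced operator norm of matrices; $\|\cdot\|_F$ is the Frobenius norm. Problem: $f(y)=\frac1n\sum_{i=1}^n f_i(y)$, $g(x)=\frac1m\sum_{j=1}^m g_j(x)$, with $f_i:\mathbb{R}^l\to\mathbb{R}$ and $g_j:\mathbb{R}^d\to\mathbb{R}^l$ smooth (not necessarily convex), and $\Phi(x)=f(g(x))$. $\partial g$ is the Jacobian, so $\nabla\Phi(x)=(\partial g(x))^T\nabla f(g(x))$. Assumptions.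 (Finite gap) $x_0\in\mathbb{R}^d$ is the initial point and $\Delta:=\Phi(x_0)-\Phi^*<\infty$, with $\Phi^*$ the global minimum value of $\Phi$. (Smoothness) For all $i,j$ and all $x,x'\in\mathbb{R}^d$, $y,y'\in\mathbb{R}^l$: $\|\partial g_j(x)-\partial g_j(x')\|_F\le L_g\|x-x'\|$, $\|\nabla f_i(y)-\nabla f_i(y')\|\le L_f\|y-y'\|$, $\|(\partial g_j(x))^T\nabla f_i(g(x))-(\partial g_j(x'))^T\nabla f_i(g(x'))\|\le L_\Phi\|x-x'\|$. (Boundedness) $\|\partial g_j(x)\|\le M_g$, $\|\nabla f_i(y)\|\le M_f$ for all $i,j,x,y$. The choice $L_\Phi=M_fL_g+M_g^2L_f$ is made. (Bounded variance) For $i,j$ uniform on $\{1,\dots,n\}$, $\{1,\dots,m\}$ and all $x,y$: $\mathbf{E}\|\nabla f_i(y)-\nabla f(y)\|^2\le H_1$, $\mathbf{E}\|\partial g_j(x)-\partial g(x)\|_F^2\le H_2$, $\mathbf{E}\|g_j(x)-g(x)\|^2\le H_3$. All constants $L_f,L_g,L_\Phi,M_f,M_g,H_1,H_2,H_3$ are positive. Minibatches: for $q=\frac1N\sum_{i=1}^N q_i$ and a minibatch $\mathcal B$ of size $B$ (indices drawn i.i.d. uniformly from $\{1,\dots,N\}$, i.e. with replacement), $q(x,\mathcal B)=\frac1B\sum_{i\in\mathcal B}q_i(x)$. STORM-Compositional algorithm. Inputs: $x_0$, $\eta>0$, $\varepsilon>0$, $a_g,a_{\partial g},a_\Phi\in(0,1)$,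 positive integer batch sizes $B_g,B_{\partial g},B_f,S_g,S_{\partial g},S_f$, and number of iterations $T$ (positive integer). Sample initial minibatches $\mathcal S_0^g,\mathcal S_0^{\partial g},\mathcal S_0^f$ of sizes $S_g,S_{\partial g},S_f$ with replacement; set $\boldsymbol g_0=g(x_0,\mathcal S_0^g)$, $\boldsymbol G_0=\partial g(x_0,\mathcal S_0^{\partial g})$, $\boldsymbol F_0=\boldsymbol G_0^T\nabla f(\boldsymbol g_0,\mathcal S_0^f)$. For $t=0,1,2,\dots$: $\widetilde x_{t+1}=x_t-\eta\boldsymbol F_t$; $x_{t+1}=x_t+\gamma_t(\widetilde x_{t+1}-x_t)$ with $\gamma_t=\min\{\frac{\eta\varepsilon}{\|\widetilde x_{t+1}-x_t\|},\frac12\}$ (equal to $\frac12$ if $\widetilde x_{t+1}=x_t$); sample with replacement fresh minibatches $\mathcal B_{t+1}^g,\mathcal B_{t+1}^{\partial g},\mathcal B_{t+1}^f$ of sizes $B_g,B_{\partial g},B_f$; set $\boldsymbol g_{t+1}=(1-a_g)\boldsymbol g_t+a_g\,g(x_{t+1},\mathcal B^g_{t+1})+(1-a_g)(g(x_{t+1},\mathcal B^g_{t+1})-g(x_t,\mathcal B^g_{t+1}))$, $\boldsymbol G_{t+1}=(1-a_{\partial g})\boldsymbol G_t+a_{\partial g}\,\partial g(x_{t+1},\mathcal B^{\partial g}_{t+1})+(1-a_{\partial g})(\partial g(x_{t+1},\mathcal B^{\partial g}_{t+1})-\partial g(x_t,\mathcal B^{\partial g}_{t+1}))$, $\boldsymbol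 F_{t+1}=(1-a_\Phi)\boldsymbol F_t+a_\Phi\boldsymbol G_{t+1}^T\nabla f(\boldsymbol g_{t+1},\mathcal B^f_{t+1})+(1-a_\Phi)[\boldsymbol G_{t+1}^T\nabla f(\boldsymbol g_{t+1},\mathcal B^f_{t+1})-\boldsymbol G_t^T\nabla f(\boldsymbol g_t,\mathcal B^f_{t+1})]$. All minibatches are mutually independent. The output $\widehat x$ is drawn uniformly at random (independently of everything else) from $x_0,\dots,x_{T-1}$. IFO complexity: an incremental first-order oracle takes an index and a point and returns $(f_i(y),\nabla f_i(y))$ or $(g_j(x),\partial g_j(x))$; the total IFO complexity of the algorithm is counted as $\mathrm{IFO}=S_g+S_{\partial g}+S_f+T(B_g+B_{\partial g}+B_f)$. *)

theory Defs
  imports "HOL-Probability.Probability" "HOL-Library.Landau_Symbols"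
begin

text \<open>
  Jacobians live in \<open>real ^ 'd ^ 'l\<close>. The library norm of that type is the Frobenius norm, as
  recorded below; the induced operator norm of a matrix \<open>A\<close> is written \<open>onorm ((*v) A)\<close>.
\<close>

lemma norm_matrix_eq_frobenius:
  fixes A :: "real ^ 'd ^ 'l"
  shows "norm A = sqrt (\<Sum>i\<in>UNIV. \<Sum>j\<in>UNIV. (A $ i $ j)\<^sup>2)"
  by (simp add: norm_vec_def L2_set_def sum_nonneg)

definition grad :: "('a::real_inner \<Rightarrow> real) \<Rightarrow> 'a \<Rightarrow> 'a" where
  "grad h x = (THE D. GDERIV h x :> D)"

abbreviation jac :: "(real ^ 'd \<Rightarrow> real ^ 'l) \<Rightarrow> real ^ 'd \<Rightarrow> real ^ 'd ^ 'l" where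
  "jac h x \<equiv> jacobian h (at x)"

definition avg :: "nat \<Rightarrow> (nat \<Rightarrow> 'a \<Rightarrow> 'b::real_vector) \<Rightarrow> 'a \<Rightarrow> 'b" where
  "avg N q x = (1 / real N) *\<^sub>R (\<Sum>i = 1..N. q i x)"

definition uniform_index :: "nat \<Rightarrow> nat pmf" where
  "uniform_index N = pmf_of_set {1..N}"

text \<open>A minibatch is the list of the indices drawn, so repetitions are kept.\<close>

definition minibatch :: "nat \<Rightarrow> nat \<Rightarrow> nat list pmf" where
  "minibatch B N = replicate_pmf B (uniform_index N)"

definition batch_avg :: "nat list \<Rightarrow> (nat \<Rightarrow> 'a \<Rightarrow> 'b::real_vector) \<Rightarrow> 'a \<Rightarrow> 'b" where
  "batch_avg b q x = (1 / real (length b)) *\<^sub>R (\<Sum>i\<leftarrow>b. q i x)"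

record storm_params =
  a_g :: real
  a_dg :: real
  a_Phi :: real
  B_g :: nat
  B_dg :: nat
  B_f :: nat
  S_g :: nat
  S_dg :: nat
  S_f :: nat
  iters :: nat

text \<open>
  A state \<open>(x, gt, Gt, Ft)\<close> holds the iterate and the estimators of \<open>g(x)\<close>, of the Jacobian
  of \<open>g\<close> at \<open>x\<close>, and of the gradient of \<open>f \<circ> g\<close> at \<open>x\<close>.
\<close>

type_synonym ('d, 'l) storm_state =
  "(real ^ 'd) \<times> (real ^ 'l) \<times> (real ^ 'd ^ 'l) \<times> (real ^ 'd)"

definition storm_init ::
  "(nat \<Rightarrow> real ^ 'l \<Rightarrow> real) \<Rightarrow> nat \<Rightarrow> (nat \<Rightarrow> real ^ 'd \<Rightarrow> real ^ 'l) \<Rightarrow> nat \<Rightarrow> real ^ 'd \<Rightarrow>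
   storm_params \<Rightarrow> ('d, 'l) storm_state pmf" where
  "storm_init f n g m x0 p = do {
     sg \<leftarrow> minibatch (S_g p) m;
     sdg \<leftarrow> minibatch (S_dg p) m;
     sf \<leftarrow> minibatch (S_f p) n;
     let gt = batch_avg sg g x0;
     let Gt = batch_avg sdg (\<lambda>j. jac (g j)) x0;
     let Ft = transpose Gt *v batch_avg sf (\<lambda>i. grad (f i)) gt;
     return_pmf (x0, gt, Gt, Ft)
   }"

definition storm_next_x :: "real \<Rightarrow> real \<Rightarrow> real ^ 'd \<Rightarrow> real ^ 'd \<Rightarrow> real ^ 'd" where
  "storm_next_x \<eta> \<epsilon> x Ft =
    (let x' = x - \<eta> *\<^sub>R Ft;
         \<gamma> = (if x' = x then 1 / 2 else min (\<eta> * \<epsilon> / norm (x' - x)) (1 / 2))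
     in x + \<gamma> *\<^sub>R (x' - x))"

fun storm_step ::
  "(nat \<Rightarrow> real ^ 'l \<Rightarrow> real) \<Rightarrow> nat \<Rightarrow> (nat \<Rightarrow> real ^ 'd \<Rightarrow> real ^ 'l) \<Rightarrow> nat \<Rightarrow>
   real \<Rightarrow> real \<Rightarrow> storm_params \<Rightarrow> ('d, 'l) storm_state \<Rightarrow> ('d, 'l) storm_state pmf" where
  "storm_step f n g m \<eta> \<epsilon> p (x, gt, Gt, Ft) = do {
     let x' = storm_next_x \<eta> \<epsilon> x Ft;
     bg \<leftarrow> minibatch (B_g p) m;
     bdg \<leftarrow> minibatch (B_dg p) m;
     bf \<leftarrow> minibatch (B_f p) n;
     let gt' = (1 - a_g p) *\<^sub>R gt + a_g p *\<^sub>R batch_avg bg g x'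
               + (1 - a_g p) *\<^sub>R (batch_avg bg g x' - batch_avg bg g x);
     let dg = batch_avg bdg (\<lambda>j. jac (g j));
     let Gt' = (1 - a_dg p) *\<^sub>R Gt + a_dg p *\<^sub>R dg x' + (1 - a_dg p) *\<^sub>R (dg x' - dg x);
     let df = batch_avg bf (\<lambda>i. grad (f i));
     let Ft' = (1 - a_Phi p) *\<^sub>R Ft + a_Phi p *\<^sub>R (transpose Gt' *v df gt')
               + (1 - a_Phi p) *\<^sub>R (transpose Gt' *v df gt' - transpose Gt *v df gt);
     return_pmf (x', gt', Gt', Ft')
   }"

text \<open>The law of the list of the states at times \<open>0, \<dots>, k\<close>.\<close>

primrec storm_run ::
  "(nat \<Rightarrow> real ^ 'l \<Rightarrow> real) \<Rightarrow> nat \<Rightarrow> (nat \<Rightarrow> real ^ 'd \<Rightarrow> real ^ 'l) \<Rightarrow> nat \<Rightarrow> real ^ 'd \<Rightarrow>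
   real \<Rightarrow> real \<Rightarrow> storm_params \<Rightarrow> nat \<Rightarrow> ('d, 'l) storm_state list pmf" where
  "storm_run f n g m x0 \<eta> \<epsilon> p 0 = map_pmf (\<lambda>s. [s]) (storm_init f n g m x0 p)"
| "storm_run f n g m x0 \<eta> \<epsilon> p (Suc k) = do {
     ss \<leftarrow> storm_run f n g m x0 \<eta> \<epsilon> p k;
     s \<leftarrow> storm_step f n g m \<eta> \<epsilon> p (last ss);
     return_pmf (ss @ [s])
   }"

definition storm_output ::
  "(nat \<Rightarrow> real ^ 'l \<Rightarrow> real) \<Rightarrow> nat \<Rightarrow> (nat \<Rightarrow> real ^ 'd \<Rightarrow> real ^ 'l) \<Rightarrow> nat \<Rightarrow> real ^ 'd \<Rightarrow>
   real \<Rightarrow> real \<Rightarrow> storm_params \<Rightarrow> (real ^ 'd) pmf" where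
  "storm_output f n g m x0 \<eta> \<epsilon> p = do {
     ss \<leftarrow> storm_run f n g m x0 \<eta> \<epsilon> p (iters p);
     t \<leftarrow> pmf_of_set {..<iters p};
     return_pmf (fst (ss ! t))
   }"

definition storm_IFO :: "storm_params \<Rightarrow> nat" where
  "storm_IFO p = S_g p + S_dg p + S_f p + iters p * (B_g p + B_dg p + B_f p)"

end

theory Submission
  imports Defs
begin

text \<open>
  Every estimator of the algorithm tracks a moving mean over finitely many component functions. An
  iterate moves by at most \<open>\<eta> * \<epsilon>\<close> in one step, and the momenta are of the order
  \<open>\<epsilon>\<close>. Each step therefore adds to the error of an estimator a centred noise of the order
  \<open>\<epsilon>\<close>, whose variance a minibatch of size \<open>1 / \<epsilon>\<close> reduces to the order
  \<open>\<epsilon> ^ 3\<close>, while the old error contracts by the factor \<open>1 - a\<close>. The mean square errors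
  \<open>v k\<close> thus satisfy \<open>v (k + 1) \<le> (1 - a) * v k + O(\<epsilon> ^ 3)\<close> with
  \<open>v 0 = O(\<epsilon>)\<close>, and their average over \<open>1 / \<epsilon>\<^sup>2\<close> iterations is
  \<open>O(\<epsilon>\<^sup>2)\<close> (\<open>sum_mean_square_le\<close>).

  This scheme (locale \<open>tracking_step\<close>) applies to \<open>g\<close> and to its Jacobian directly. The
  gradient estimator tracks a product of the other two estimators, and its noise is small only if
  these are bounded and move slowly. Both hold surely (\<open>tame\<close>): over finitely many indices the
  variance bound is a bound on every single deviation, and a momentum of at least \<open>c * \<epsilon>\<close>
  keeps the accumulated errors below a constant.

  The smoothness of \<open>\<Phi>\<close> turns the step of the algorithm into a decrease of \<open>\<Phi>\<close> by a
  multiple of \<open>\<epsilon> * norm F\<close>, up to \<open>O(\<epsilon>\<^sup>2)\<close> and to \<open>\<epsilon>\<close> times the error of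
  the direction \<open>F\<close> (\<open>descent_step\<close>). Summed over the run and divided by the number of
  iterations, this bounds the mean norm of the direction, and with it that of the gradient of
  \<open>\<Phi>\<close>, by \<open>O(\<epsilon>)\<close>.
\<close>

section \<open>Expectations over finitely supported distributions\<close>

lemma expectation_mono_on_support:
  fixes h k :: "'a \<Rightarrow> real"
  assumes "finite (set_pmf p)" "\<And>x. x \<in> set_pmf p \<Longrightarrow> h x \<le> k x"
  shows "measure_pmf.expectation p h \<le> measure_pmf.expectation p k"
  using assms
  by (intro integral_mono_AE) (auto simp: AE_measure_pmf_iff integrable_measure_pmf_finite)

lemma expectation_cong_on_support:
  fixes h k :: "'a \<Rightarrow> real"
  assumes "\<And>x. x \<in> set_pmf p \<Longrightarrow> h x = k x"
  shows "measure_pmf.expectation p h = measure_pmf.expectation p k"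
  using assms by (intro integral_cong_AE) (auto simp: AE_measure_pmf_iff)

lemma expectation_bind_finite:
  fixes h :: "'b \<Rightarrow> real"
  assumes "finite (set_pmf p)" "\<And>x. x \<in> set_pmf p \<Longrightarrow> finite (set_pmf (q x))"
  shows "measure_pmf.expectation (p \<bind> q) h
         = measure_pmf.expectation p (\<lambda>x. measure_pmf.expectation (q x) h)"
  using assms
  by (subst pmf_expectation_bind[of "set_pmf p"])
     (auto simp: integral_measure_pmf[of "set_pmf p"])

lemma expectation_le_const:
  fixes h :: "'a \<Rightarrow> real"
  assumes "finite (set_pmf p)" "\<And>x. x \<in> set_pmf p \<Longrightarrow> h x \<le> c"
  shows "measure_pmf.expectation p h \<le> c"
  using expectation_mono_on_support[of p h "\<lambda>_. c"] assms by simp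

section \<open>Minibatch means\<close>

definition sample_mean :: "nat list \<Rightarrow> (nat \<Rightarrow> 'b::real_vector) \<Rightarrow> 'b" where
  "sample_mean b u = (1 / real (length b)) *\<^sub>R (\<Sum>i\<leftarrow>b. u i)"

definition index_mean :: "nat \<Rightarrow> (nat \<Rightarrow> 'b::real_vector) \<Rightarrow> 'b" where
  "index_mean N u = (1 / real N) *\<^sub>R (\<Sum>i = 1..N. u i)"

lemma batch_avg_eq_sample_mean: "batch_avg b q x = sample_mean b (\<lambda>i. q i x)"
  by (simp add: batch_avg_def sample_mean_def)

lemma avg_eq_index_mean: "avg N q x = index_mean N (\<lambda>i. q i x)"
  by (simp add: avg_def index_mean_def)

lemma sample_mean_add: "sample_mean b (\<lambda>i. u i + w i) = sample_mean b u + sample_mean b w"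
  by (simp add: sample_mean_def sum_list_addf scaleR_add_right)

lemma sum_list_scaleR: "(\<Sum>i\<leftarrow>b. c *\<^sub>R u i) = c *\<^sub>R (\<Sum>i\<leftarrow>b. u i :: 'b::real_vector)"
  by (induction b) (auto simp: scaleR_add_right)

lemma sample_mean_scaleR: "sample_mean b (\<lambda>i. c *\<^sub>R u i) = c *\<^sub>R sample_mean b u"
  by (simp add: sample_mean_def sum_list_scaleR)

lemma sample_mean_diff: "sample_mean b (\<lambda>i. u i - w i) = sample_mean b u - sample_mean b w"
  using sample_mean_add[of b u "\<lambda>i. (-1) *\<^sub>R w i"] sample_mean_scaleR[of b "-1" w] by simp

lemma sample_mean_const: "b \<noteq> [] \<Longrightarrow> sample_mean b (\<lambda>_. v) = v"
proof -
  have "(\<Sum>i\<leftarrow>b. v) = real (length b) *\<^sub>R v"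
    by (induction b) (auto simp: scaleR_add_left)
  then show "b \<noteq> [] \<Longrightarrow> sample_mean b (\<lambda>_. v) = v" by (simp add: sample_mean_def)
qed

lemma index_mean_add: "index_mean N (\<lambda>i. u i + w i) = index_mean N u + index_mean N w"
  by (simp add: index_mean_def sum.distrib scaleR_add_right)

lemma index_mean_scaleR: "index_mean N (\<lambda>i. c *\<^sub>R u i) = c *\<^sub>R index_mean N u"
  by (simp add: index_mean_def scaleR_sum_right mult.commute)

lemma index_mean_diff: "index_mean N (\<lambda>i. u i - w i) = index_mean N u - index_mean N w"
  by (simp add: index_mean_def sum_subtractf scaleR_diff_right)

lemma index_mean_const: "N \<ge> 1 \<Longrightarrow> index_mean N (\<lambda>_. v) = v"
  by (simp add: index_mean_def scaleR_sum_right sum_constant_scaleR)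

lemma sample_mean_linear: "linear h \<Longrightarrow> h (sample_mean b u) = sample_mean b (\<lambda>i. h (u i))"
proof -
  assume h: "linear h"
  have "h (\<Sum>i\<leftarrow>b. u i) = (\<Sum>i\<leftarrow>b. h (u i))"
    by (induction b) (auto simp: linear_0[OF h] linear_add[OF h])
  then show ?thesis by (simp add: sample_mean_def linear_scale[OF h])
qed

lemma index_mean_linear: "linear h \<Longrightarrow> h (index_mean N u) = index_mean N (\<lambda>i. h (u i))"
  by (simp add: index_mean_def linear_scale linear_sum)

lemma norm_sample_mean_le:
  assumes "b \<noteq> []" "\<And>i. i \<in> set b \<Longrightarrow> norm (u i) \<le> r"
  shows "norm (sample_mean b u) \<le> r"
proof -
  have "norm (\<Sum>i\<leftarrow>b. u i) \<le> real (length b) * r"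
    using assms(2)
  proof (induction b)
    case (Cons i b)
    then have "norm (u i) \<le> r" "norm (\<Sum>i\<leftarrow>b. u i) \<le> real (length b) * r" by auto
    then show ?case
      using norm_triangle_ineq[of "u i" "\<Sum>i\<leftarrow>b. u i"] by (simp add: algebra_simps)
  qed simp
  then show ?thesis using assms(1)
    by (simp add: sample_mean_def divide_simps mult.commute)
qed

lemma norm_index_mean_le:
  assumes "N \<ge> 1" "\<And>i. i \<in> {1..N} \<Longrightarrow> norm (u i) \<le> r"
  shows "norm (index_mean N u) \<le> r"
proof -
  have "norm (\<Sum>i = 1..N. u i) \<le> real N * r"
    using sum_norm_le[of "{1..N}" u "\<lambda>_. r"] assms(2) by auto
  then show ?thesis using assms(1)
    by (simp add: index_mean_def divide_simps mult.commute)
qed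

lemma set_minibatch:
  assumes "N \<ge> 1"
  shows "set_pmf (minibatch B N) = {b \<in> lists {1..N}. length b = B}"
  using assms by (simp add: minibatch_def set_replicate_pmf uniform_index_def set_pmf_of_set)

lemma finite_minibatch:
  assumes "N \<ge> 1"
  shows "finite (set_pmf (minibatch B N))"
  using finite_lists_length_eq[of "{1..N}" B]
  by (simp add: set_minibatch[OF assms] lists_eq_set)

lemma expectation_uniform_index:
  assumes "N \<ge> 1"
  shows "measure_pmf.expectation (uniform_index N) h = index_mean N (h :: nat \<Rightarrow> real)"
  using assms by (simp add: uniform_index_def integral_pmf_of_set index_mean_def)

text \<open>
  In the second moment of a sum of independent centred draws the cross terms vanish. The offset
  \<open>e\<close> is arbitrary so that the induction over the draws can absorb the first draw into it.
\<close>

lemma expectation_norm_sum_minibatch: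
  fixes q :: "nat \<Rightarrow> 'b::real_inner"
  assumes N: "N \<ge> 1" and centred: "index_mean N q = 0"
  shows "measure_pmf.expectation (minibatch B N) (\<lambda>b. (norm (e + (\<Sum>i\<leftarrow>b. q i)))\<^sup>2)
         = (norm e)\<^sup>2 + real B * index_mean N (\<lambda>i. (norm (q i))\<^sup>2)"
proof (induction B arbitrary: e)
  case 0
  then show ?case by (simp add: minibatch_def)
next
  case (Suc B)
  define V where "V = index_mean N (\<lambda>i. (norm (q i))\<^sup>2)"
  have fin: "finite (set_pmf (uniform_index N))"
    using N by (simp add: uniform_index_def)
  have inner0: "index_mean N (\<lambda>i. e \<bullet> q i) = 0"
    using index_mean_linear[of "\<lambda>v. e \<bullet> v" N q] centred
    by (simp add: bounded_linear.linear bounded_linear_inner_right)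
  have "minibatch (Suc B) N
        = uniform_index N \<bind> (\<lambda>j. map_pmf (\<lambda>b. j # b) (minibatch B N))"
    by (simp add: minibatch_def map_pmf_def)
  then have "measure_pmf.expectation (minibatch (Suc B) N) (\<lambda>b. (norm (e + (\<Sum>i\<leftarrow>b. q i)))\<^sup>2)
     = measure_pmf.expectation (uniform_index N) (\<lambda>j.
         measure_pmf.expectation (minibatch B N) (\<lambda>b. (norm ((e + q j) + (\<Sum>i\<leftarrow>b. q i)))\<^sup>2))"
    by (simp add: expectation_bind_finite fin finite_minibatch[OF N] add.assoc)
  also have "\<dots> = measure_pmf.expectation (uniform_index N) (\<lambda>j. (norm (e + q j))\<^sup>2 + real B * V)"
    by (simp only: Suc V_def)
  also have "\<dots> = index_mean N (\<lambda>j. ((norm e)\<^sup>2 + real B * V) + 2 *\<^sub>R (e \<bullet> q j) + (norm (q j))\<^sup>2)"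
    by (simp add: expectation_uniform_index[OF N] power2_norm_eq_inner inner_add inner_commute
        algebra_simps)
  also have "\<dots> = (norm e)\<^sup>2 + real (Suc B) * V"
    by (simp only: index_mean_add index_mean_scaleR index_mean_const[OF N] inner0 V_def)
       (simp add: algebra_simps)
  finally show ?case by (simp add: V_def)
qed

text \<open>
  Averaging over \<open>B\<close> draws divides the second moment of the noise by \<open>B\<close>. A square
  bound on every single \<open>q i\<close> suffices here, because all noises below are bounded surely.
\<close>

lemma expectation_norm_sample_mean_le:
  fixes q :: "nat \<Rightarrow> 'b::real_inner"
  assumes N: "N \<ge> 1" and B: "B > 0" and centred: "index_mean N q = 0"
    and bound: "\<And>i. i \<in> {1..N} \<Longrightarrow> norm (q i) \<le> r"
  shows "measure_pmf.expectation (minibatch B N) (\<lambda>b. (norm (e + sample_mean b q))\<^sup>2)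
         \<le> (norm e)\<^sup>2 + r\<^sup>2 / real B"
proof -
  have "measure_pmf.expectation (minibatch B N) (\<lambda>b. (norm (e + sample_mean b q))\<^sup>2)
      = measure_pmf.expectation (minibatch B N)
          (\<lambda>b. (norm (e + (\<Sum>i\<leftarrow>b. (1 / real B) *\<^sub>R q i)))\<^sup>2)"
    by (rule expectation_cong_on_support)
       (simp add: set_minibatch[OF N] sample_mean_def sum_list_scaleR)
  also have "\<dots> = (norm e)\<^sup>2 + real B * index_mean N (\<lambda>i. (norm ((1 / real B) *\<^sub>R q i))\<^sup>2)"
    using index_mean_scaleR[of N "1 / real B" q] centred
    by (intro expectation_norm_sum_minibatch[OF N]) simp
  also have "index_mean N (\<lambda>i. (norm ((1 / real B) *\<^sub>R q i))\<^sup>2) \<le> (r / real B)\<^sup>2"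
  proof -
    have "norm (index_mean N (\<lambda>i. (norm ((1 / real B) *\<^sub>R q i))\<^sup>2)) \<le> (r / real B)\<^sup>2"
      using bound B
      by (intro norm_index_mean_le[OF N]) (auto intro!: power_mono divide_right_mono simp: power_divide)
    then show ?thesis by simp
  qed
  finally show ?thesis using B by (simp add: power2_eq_square mult_left_mono)
qed

text \<open>
  Over finitely many indices a bound on the variance is a bound on every single deviation. The
  price is a factor \<open>N\<close>, which does not depend on the precision.
\<close>

lemma deviation_le_of_variance_le:
  fixes u :: "nat \<Rightarrow> 'b::real_normed_vector"
  assumes N: "N \<ge> 1" and H: "H \<ge> 0" and i: "i \<in> {1..N}"
    and var: "measure_pmf.expectation (uniform_index N) (\<lambda>i. (norm (u i - v))\<^sup>2) \<le> H"
  shows "norm (u i - v) \<le> sqrt (real N * H)"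
proof -
  have "(norm (u i - v))\<^sup>2 \<le> (\<Sum>i = 1..N. (norm (u i - v))\<^sup>2)"
    using i by (intro member_le_sum) auto
  also have "\<dots> \<le> real N * H"
    using var N by (simp add: expectation_uniform_index index_mean_def divide_simps mult.commute)
  finally show ?thesis by (simp add: real_le_rsqrt)
qed

section \<open>The recursive momentum estimator\<close>

text \<open>
  The one rule by which all three estimators are updated: \<open>u i\<close> and \<open>w i\<close> are the values
  of the \<open>i\<close>-th component function at the old and at the new state.
\<close>

definition momentum_update ::
  "real \<Rightarrow> 'b \<Rightarrow> nat list \<Rightarrow> (nat \<Rightarrow> 'b) \<Rightarrow> (nat \<Rightarrow> 'b) \<Rightarrow> 'b::real_vector" where
  "momentum_update a e b u w =
     (1 - a) *\<^sub>R e + a *\<^sub>R sample_mean b w + (1 - a) *\<^sub>R (sample_mean b w - sample_mean b u)"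

text \<open>
  One step of an estimator whose target moves from the mean of \<open>u\<close> to the mean of \<open>w\<close>.
  The deviation \<open>\<sigma>\<close> enters the noise only multiplied by the momentum \<open>a\<close>, and
  \<open>\<delta>\<close> is the distance that a component moves. In the algorithm both \<open>a\<close> and
  \<open>\<delta>\<close> are of the order of the precision, and hence so is the noise.
\<close>

locale tracking_step =
  fixes N :: nat and a \<sigma> \<delta> :: real and u w :: "nat \<Rightarrow> 'b::real_inner"
  assumes N: "N \<ge> 1" and a: "0 < a" "a < 1"
    and dev_old: "\<And>i. i \<in> {1..N} \<Longrightarrow> norm (u i - index_mean N u) \<le> \<sigma>"
    and dev_new: "\<And>i. i \<in> {1..N} \<Longrightarrow> norm (w i - index_mean N w) \<le> \<sigma>"
    and move: "\<And>i. i \<in> {1..N} \<Longrightarrow> norm (w i - u i) \<le> \<delta>"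
begin

definition noise :: "nat \<Rightarrow> 'b" where
  "noise i = (w i - (1 - a) *\<^sub>R u i) - (index_mean N w - (1 - a) *\<^sub>R index_mean N u)"

lemma centred_noise: "index_mean N noise = 0"
  unfolding noise_def
  by (simp add: index_mean_diff index_mean_scaleR index_mean_const[OF N])

text \<open>
  The same indices are evaluated at the old and at the new state. The noise therefore splits into
  \<open>a\<close> times a deviation at the new state and \<open>1 - a\<close> times the deviation of a mere
  increment.
\<close>

lemma norm_noise_le:
  assumes i: "i \<in> {1..N}"
  shows "norm (noise i) \<le> a * \<sigma> + 2 * \<delta>"
proof -
  have mean_move: "norm (index_mean N w - index_mean N u) \<le> \<delta>"
    unfolding index_mean_diff[symmetric] by (rule norm_index_mean_le[OF N move])
  have "noise i = a *\<^sub>R (w i - index_mean N w)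
          + (1 - a) *\<^sub>R ((w i - u i) - (index_mean N w - index_mean N u))"
    by (simp add: noise_def algebra_simps)
  also have "norm \<dots> \<le> norm (a *\<^sub>R (w i - index_mean N w))
          + norm ((1 - a) *\<^sub>R ((w i - u i) - (index_mean N w - index_mean N u)))"
    by (rule norm_triangle_ineq)
  also have "\<dots> \<le> a * \<sigma> + 1 * (norm (w i - u i) + norm (index_mean N w - index_mean N u))"
    unfolding norm_scaleR
    using a dev_new[OF i] norm_triangle_ineq4[of "w i - u i" "index_mean N w - index_mean N u"]
    by (intro add_mono mult_mono) auto
  also have "\<dots> \<le> a * \<sigma> + 2 * \<delta>" using move[OF i] mean_move by simp
  finally show ?thesis .
qed

lemma momentum_update_error:
  assumes "b \<noteq> []"
  shows "momentum_update a e b u w - index_mean N w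
         = (1 - a) *\<^sub>R (e - index_mean N u) + sample_mean b noise"
proof -
  have "sample_mean b noise = (sample_mean b w - (1 - a) *\<^sub>R sample_mean b u)
          - (index_mean N w - (1 - a) *\<^sub>R index_mean N u)"
    unfolding noise_def
    using assms by (simp add: sample_mean_diff sample_mean_scaleR sample_mean_const)
  then show ?thesis by (simp add: momentum_update_def algebra_simps)
qed

lemma momentum_update_error_le:
  assumes "b \<noteq> []" "b \<in> lists {1..N}"
  shows "norm (momentum_update a e b u w - index_mean N w)
         \<le> (1 - a) * norm (e - index_mean N u) + (a * \<sigma> + 2 * \<delta>)"
proof -
  have "norm (sample_mean b noise) \<le> a * \<sigma> + 2 * \<delta>"
    using assms norm_noise_le by (intro norm_sample_mean_le) (auto simp: in_lists_conv_set)
  then show ?thesis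
    using norm_triangle_ineq[of "(1 - a) *\<^sub>R (e - index_mean N u)" "sample_mean b noise"] a
    unfolding momentum_update_error[OF assms(1)] by simp
qed

lemma momentum_update_move_le:
  assumes "b \<noteq> []" "b \<in> lists {1..N}"
  shows "norm (momentum_update a e b u w - e) \<le> a * (norm (e - index_mean N u) + \<sigma>) + \<delta>"
proof -
  have eq: "momentum_update a e b u w - e
     = a *\<^sub>R (sample_mean b (\<lambda>i. u i - index_mean N u) - (e - index_mean N u))
       + sample_mean b (\<lambda>i. w i - u i)"
    using assms(1)
    by (simp add: momentum_update_def sample_mean_diff sample_mean_const algebra_simps)
  have "norm (sample_mean b (\<lambda>i. u i - index_mean N u)) \<le> \<sigma>"
    "norm (sample_mean b (\<lambda>i. w i - u i)) \<le> \<delta>"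
    using assms dev_old move by (auto intro!: norm_sample_mean_le simp: in_lists_conv_set)
  then have "norm (sample_mean b (\<lambda>i. u i - index_mean N u) - (e - index_mean N u))
               \<le> norm (e - index_mean N u) + \<sigma>"
    using norm_triangle_ineq4[of "sample_mean b (\<lambda>i. u i - index_mean N u)" "e - index_mean N u"]
    by linarith
  then have "a * norm (sample_mean b (\<lambda>i. u i - index_mean N u) - (e - index_mean N u))
               \<le> a * (norm (e - index_mean N u) + \<sigma>)"
    using a by simp
  then show ?thesis
    unfolding eq using \<open>norm (sample_mean b (\<lambda>i. w i - u i)) \<le> \<delta>\<close> a
    by (intro order_trans[OF norm_triangle_ineq] add_mono) auto
qed

lemma expectation_momentum_update_error_le:
  assumes B: "B > 0"
  shows "measure_pmf.expectation (minibatch B N)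
           (\<lambda>b. (norm (momentum_update a e b u w - index_mean N w))\<^sup>2)
         \<le> (1 - a) * (norm (e - index_mean N u))\<^sup>2 + (a * \<sigma> + 2 * \<delta>)\<^sup>2 / real B"
proof -
  have "measure_pmf.expectation (minibatch B N)
          (\<lambda>b. (norm (momentum_update a e b u w - index_mean N w))\<^sup>2)
      = measure_pmf.expectation (minibatch B N)
          (\<lambda>b. (norm ((1 - a) *\<^sub>R (e - index_mean N u) + sample_mean b noise))\<^sup>2)"
    using B by (intro expectation_cong_on_support)
      (auto simp: set_minibatch[OF N] momentum_update_error)
  also have "\<dots> \<le> (norm ((1 - a) *\<^sub>R (e - index_mean N u)))\<^sup>2 + (a * \<sigma> + 2 * \<delta>)\<^sup>2 / real B"
    by (rule expectation_norm_sample_mean_le[OF N B centred_noise norm_noise_le])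
  also have "(norm ((1 - a) *\<^sub>R (e - index_mean N u)))\<^sup>2
             = (1 - a)\<^sup>2 * (norm (e - index_mean N u))\<^sup>2"
    using a by (simp add: power_mult_distrib)
  also have "(1 - a)\<^sup>2 * (norm (e - index_mean N u))\<^sup>2 \<le> (1 - a) * (norm (e - index_mean N u))\<^sup>2"
    using a by (intro mult_right_mono) (auto simp: power2_eq_square mult_left_le)
  finally show ?thesis by simp
qed

end

lemma sample_mean_error_le:
  assumes "N \<ge> 1" "b \<noteq> []" "b \<in> lists {1..N}"
    and "\<And>i. i \<in> {1..N} \<Longrightarrow> norm (u i - index_mean N u) \<le> \<sigma>"
  shows "norm (sample_mean b u - index_mean N u) \<le> \<sigma>"
  using norm_sample_mean_le[of b "\<lambda>i. u i - index_mean N u" \<sigma>] assms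
  by (auto simp: sample_mean_diff sample_mean_const in_lists_conv_set)

lemma expectation_sample_mean_error_le:
  fixes u :: "nat \<Rightarrow> 'b::real_inner"
  assumes N: "N \<ge> 1" and B: "B > 0"
    and dev: "\<And>i. i \<in> {1..N} \<Longrightarrow> norm (u i - index_mean N u) \<le> \<sigma>"
  shows "measure_pmf.expectation (minibatch B N) (\<lambda>b. (norm (sample_mean b u - index_mean N u))\<^sup>2)
         \<le> \<sigma>\<^sup>2 / real B"
proof -
  have "measure_pmf.expectation (minibatch B N) (\<lambda>b. (norm (sample_mean b u - index_mean N u))\<^sup>2)
     = measure_pmf.expectation (minibatch B N)
         (\<lambda>b. (norm (0 + sample_mean b (\<lambda>i. u i - index_mean N u)))\<^sup>2)"
    using B by (intro expectation_cong_on_support)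
      (auto simp: set_minibatch[OF N] sample_mean_diff sample_mean_const)
  also have "\<dots> \<le> (norm (0::'b))\<^sup>2 + \<sigma>\<^sup>2 / real B"
    by (rule expectation_norm_sample_mean_le[OF N B _ dev])
       (simp_all add: index_mean_diff index_mean_const[OF N])
  finally show ?thesis by simp
qed

text \<open>
  Each step forgets a fraction \<open>a\<close> of the old error, so the initial error \<open>v 0\<close> is paid for only
  \<open>1 / a\<close> times in the whole sum. This is why initial batches of the size of the later ones are
  large enough.
\<close>

lemma contraction_sum_le:
  fixes v :: "nat \<Rightarrow> real"
  assumes a: "a > 0" and v: "\<And>k. v k \<ge> 0" and rec: "\<And>k. v (Suc k) \<le> (1 - a) * v k + D"
  shows "(\<Sum>k<T. v k) \<le> (v 0 + real T * D) / a"
proof -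
  have "a * (\<Sum>k<T. v k) + v T \<le> v 0 + real T * D"
  proof (induction T)
    case (Suc T)
    then show ?case using rec[of T] by (simp add: algebra_simps)
  qed simp
  then have "a * (\<Sum>k<T. v k) \<le> v 0 + real T * D" using v[of T] by linarith
  then show ?thesis using a by (simp add: pos_le_divide_eq mult.commute)
qed

section \<open>Gradients, Jacobians and descent\<close>

(* Products with a transposed matrix stay in the form in which the algorithm uses them. *)
declare transpose_matrix_vector [simp del]

lemma grad_eq: "GDERIV h x :> D \<Longrightarrow> grad h x = D"
proof -
  assume D: "GDERIV h x :> D"
  have "D' = D" if "GDERIV h x :> D'" for D'
  proof -
    have "(\<lambda>v. v \<bullet> D') = (\<lambda>v. v \<bullet> D)"
      using has_derivative_unique that D unfolding gderiv_def by blast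
    then show ?thesis by (metis inner_commute vector_eq_rdot)
  qed
  then show ?thesis unfolding grad_def using D by blast
qed

lemma GDERIV_grad:
  fixes h :: "'a::euclidean_space \<Rightarrow> real"
  assumes "h differentiable (at x)"
  shows "GDERIV h x :> grad h x"
proof -
  obtain h' where h': "(h has_derivative h') (at x)"
    using assms by (auto simp: differentiable_def)
  define D where "D = (\<Sum>b\<in>Basis. h' b *\<^sub>R b)"
  have lin: "linear h'" using h' by (rule has_derivative_linear)
  have "h' v = v \<bullet> D" for v
  proof -
    have "h' v = h' (\<Sum>b\<in>Basis. (v \<bullet> b) *\<^sub>R b)" by (simp add: euclidean_representation)
    also have "\<dots> = v \<bullet> D"
      by (simp add: linear_sum[OF lin] linear_scale[OF lin] D_def inner_sum_right mult.commute)
    finally show ?thesis .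
  qed
  then have "GDERIV h x :> D" using h' unfolding gderiv_def by presburger
  then show ?thesis using grad_eq by metis
qed

lemma GDERIV_avg:
  assumes "\<And>i. i \<in> {1..N} \<Longrightarrow> GDERIV (q i) x :> D i"
  shows "GDERIV (avg N q) x :> index_mean N D"
proof -
  have "((\<lambda>x. (1 / real N) *\<^sub>R (\<Sum>i = 1..N. q i x)) has_derivative
         (\<lambda>h. (1 / real N) *\<^sub>R (\<Sum>i = 1..N. h \<bullet> D i))) (at x)"
    using assms unfolding gderiv_def
    by (intro has_derivative_scaleR_right has_derivative_sum) auto
  moreover have "avg N q = (\<lambda>x. (1 / real N) *\<^sub>R (\<Sum>i = 1..N. q i x))"
    by (auto simp: avg_def)
  ultimately show ?thesis
    by (simp add: gderiv_def index_mean_def inner_sum_right)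
qed

lemma jac_eq: "(h has_derivative (\<lambda>v. A *v v)) (at x) \<Longrightarrow> jac h x = A"
  by (metis frechet_derivative_at jacobian_def matrix_of_matrix_vector_mul)

lemma linear_matrix_apply: "linear (\<lambda>A::real^'d^'l. A *v v)"
  by (rule linearI) (simp_all add: matrix_vector_mult_add_rdistrib scaleR_matrix_vector_assoc)

lemma linear_transpose_apply: "linear (\<lambda>A::real^'d^'l. transpose A *v v)"
  by (rule linearI)
     (simp_all add: vec_eq_iff transpose_def matrix_vector_mult_def sum.distrib sum_distrib_left
        algebra_simps)

lemma has_derivative_avg_jac:
  fixes q :: "nat \<Rightarrow> real^'d \<Rightarrow> real^'l"
  assumes "\<And>i. i \<in> {1..N} \<Longrightarrow> q i differentiable (at x)"
  shows "(avg N q has_derivative (\<lambda>v. index_mean N (\<lambda>i. jac (q i) x) *v v)) (at x)"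
proof -
  have "((\<lambda>x. (1 / real N) *\<^sub>R (\<Sum>i = 1..N. q i x)) has_derivative
         (\<lambda>h. (1 / real N) *\<^sub>R (\<Sum>i = 1..N. jac (q i) x *v h))) (at x)"
    using assms by (intro has_derivative_scaleR_right has_derivative_sum) (auto simp: jacobian_works)
  moreover have "avg N q = (\<lambda>x. (1 / real N) *\<^sub>R (\<Sum>i = 1..N. q i x))"
    by (auto simp: avg_def)
  moreover have "index_mean N (\<lambda>i. jac (q i) x) *v h
                 = (1 / real N) *\<^sub>R (\<Sum>i = 1..N. jac (q i) x *v h)" for h
    using index_mean_linear[OF linear_matrix_apply, of N "\<lambda>i. jac (q i) x" h]
    by (simp add: index_mean_def)
  ultimately show ?thesis by simp
qed

lemma norm_matrix_vector_le:
  fixes A :: "real^'d^'l"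
  shows "norm (A *v v) \<le> norm A * norm v"
proof -
  have "norm (A *v v) \<le> norm (\<chi> i. norm (A $ i) * norm v)"
    by (rule norm_le_componentwise_cart)
       (simp add: matrix_vector_mul_component Cauchy_Schwarz_ineq2)
  also have "\<dots> = norm A * norm v"
    by (simp add: norm_vec_def[of "\<chi> i. norm (A $ i) * norm v"] norm_vec_def[of A]
        L2_set_left_distrib)
  finally show ?thesis .
qed

text \<open>
  A matrix and its transpose have the same operator norm, because
  \<open>A\<^sup>T y \<bullet> A\<^sup>T y = y \<bullet> A A\<^sup>T y\<close>.
\<close>

lemma norm_transpose_apply_le:
  fixes A :: "real^'d^'l"
  assumes "\<And>v. norm (A *v v) \<le> M * norm v"
  shows "norm (transpose A *v y) \<le> M * norm y"
proof (cases "transpose A *v y = 0")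
  case True
  have "0 \<le> M * norm y"
  proof -
    (* A unit vector exists, so the assumption forces \<open>M\<close> to be nonnegative. *)
    obtain i :: 'd where True by blast
    have "0 \<le> M * norm (axis i (1::real))" using assms[of "axis i 1"] norm_ge_zero order_trans by blast
    then have "0 \<le> M" by simp
    then show ?thesis by simp
  qed
  then show ?thesis using True by simp
next
  case False
  have "(norm (transpose A *v y))\<^sup>2 = y \<bullet> (A *v (transpose A *v y))"
    by (simp add: power2_norm_eq_inner dot_lmul_matrix[symmetric] transpose_matrix_vector)
  also have "\<dots> \<le> norm y * (M * norm (transpose A *v y))"
    using norm_cauchy_schwarz[of y] assms[of "transpose A *v y"]
    by (meson mult_left_mono norm_ge_zero order_trans)
  finally have "norm (transpose A *v y) * norm (transpose A *v y)
                \<le> (M * norm y) * norm (transpose A *v y)"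
    by (simp only: power2_eq_square mult_ac)
  moreover have "norm (transpose A *v y) > 0" using False by (rule zero_less_norm_iff[THEN iffD2])
  ultimately show ?thesis by (simp only: mult_le_cancel_right_pos)
qed

lemma norm_transpose_apply_le_norm:
  fixes A :: "real^'d^'l"
  shows "norm (transpose A *v y) \<le> norm A * norm y"
  by (rule norm_transpose_apply_le[OF norm_matrix_vector_le])

lemma quadratic_upper_bound:
  fixes h :: "'a::real_inner \<Rightarrow> real"
  assumes grad: "\<And>x. GDERIV h x :> D x"
    and lip: "\<And>x y. norm (D x - D y) \<le> L * norm (x - y)"
  shows "h y \<le> h x + D x \<bullet> (y - x) + L / 2 * (norm (y - x))\<^sup>2"
proof -
  define d where "d = y - x"
  define \<phi> where "\<phi> = (\<lambda>t. h (x + t *\<^sub>R d) - t * (D x \<bullet> d) - L / 2 * t\<^sup>2 * (norm d)\<^sup>2)"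
  have "\<phi> 1 \<le> \<phi> 0"
  proof (rule DERIV_nonpos_imp_nonincreasing[where f = \<phi> and a = 0 and b = 1])
    fix t :: real assume t: "0 \<le> t" "t \<le> 1"
    define s where "s = (D (x + t *\<^sub>R d) - D x) \<bullet> d - L * t * (norm d)\<^sup>2"
    have "((\<lambda>t. h (x + t *\<^sub>R d)) has_derivative (\<lambda>r. (r *\<^sub>R d) \<bullet> D (x + t *\<^sub>R d))) (at t)"
    proof (rule has_derivative_compose[where g = h and f = "\<lambda>t. x + t *\<^sub>R d"])
      show "((\<lambda>t. x + t *\<^sub>R d) has_derivative (\<lambda>r. r *\<^sub>R d)) (at t)"
        by (auto intro!: derivative_eq_intros)
      show "(h has_derivative (\<lambda>v. v \<bullet> D (x + t *\<^sub>R d))) (at (x + t *\<^sub>R d))"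
        using grad unfolding gderiv_def .
    qed
    then have "((\<lambda>t. h (x + t *\<^sub>R d)) has_field_derivative d \<bullet> D (x + t *\<^sub>R d)) (at t)"
      by (simp add: has_field_derivative_def mult_commute_abs)
    then have "DERIV \<phi> t :> s"
      unfolding \<phi>_def s_def
      by (auto intro!: derivative_eq_intros simp: inner_diff_right inner_commute[of "D _" d]
          inner_commute[of "D _ - D _" d])
    moreover have "s \<le> 0"
    proof -
      have "(D (x + t *\<^sub>R d) - D x) \<bullet> d \<le> norm (D (x + t *\<^sub>R d) - D x) * norm d"
        by (rule norm_cauchy_schwarz)
      also have "\<dots> \<le> (L * norm (t *\<^sub>R d)) * norm d"
        using lip[of "x + t *\<^sub>R d" x] by (intro mult_right_mono) auto
      finally show ?thesis using t by (simp add: s_def power2_eq_square)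
    qed
    ultimately show "\<exists>s. DERIV \<phi> t :> s \<and> s \<le> 0" by blast
  qed simp
  then show ?thesis by (simp add: \<phi>_def d_def)
qed

text \<open>
  The step is either cut off at length \<open>\<eta> * \<epsilon>\<close>, and then
  \<open>\<gamma> * norm F = \<epsilon>\<close>, or it is half a gradient step, and then
  \<open>norm F < 2 * \<epsilon>\<close>. The last inequality treats both cases at once: it makes the
  decrease linear in \<open>norm F\<close> at the price of \<open>2 * \<epsilon>\<^sup>2\<close>.
\<close>

lemma storm_next_x_cases:
  assumes "\<eta> > 0" "\<epsilon> > 0"
  obtains \<gamma> where "storm_next_x \<eta> \<epsilon> x F = x - (\<gamma> * \<eta>) *\<^sub>R F" "0 \<le> \<gamma>" "\<gamma> \<le> 1 / 2"
    "\<gamma> * norm F \<le> \<epsilon>" "\<epsilon> * norm F - 2 * \<epsilon>\<^sup>2 \<le> \<gamma> * (norm F)\<^sup>2"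
proof (cases "F = 0")
  case True
  then show ?thesis using assms
    by (intro that[of "1/2"]) (auto simp: storm_next_x_def)
next
  case False
  define \<gamma> where "\<gamma> = min (\<epsilon> / norm F) (1 / 2)"
  have F: "norm F > 0" using False by simp
  have "storm_next_x \<eta> \<epsilon> x F = x - (\<gamma> * \<eta>) *\<^sub>R F"
    using assms False by (simp add: storm_next_x_def \<gamma>_def Let_def)
  moreover have "\<epsilon> * norm F - 2 * \<epsilon>\<^sup>2 \<le> \<gamma> * (norm F)\<^sup>2"
  proof (cases "\<epsilon> / norm F \<le> 1 / 2")
    case True
    then show ?thesis using F by (simp add: \<gamma>_def power2_eq_square)
  next
    case False
    (* Half the right-hand side is \<open>(norm F)\<^sup>2 / 2 - (\<epsilon> * norm F - 2 * \<epsilon>\<^sup>2)\<close>. *)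
    have "0 \<le> (norm F - \<epsilon>)\<^sup>2 + 3 * \<epsilon>\<^sup>2" by simp
    then show ?thesis using F False by (simp add: \<gamma>_def power2_eq_square algebra_simps)
  qed
  moreover have "\<gamma> * norm F \<le> \<epsilon>"
    using F by (simp add: \<gamma>_def min_def divide_simps) 
  moreover have "\<gamma> \<le> 1 / 2" unfolding \<gamma>_def by (rule min.cobounded2)
  moreover have "0 \<le> \<gamma>" using assms F by (simp add: \<gamma>_def)
  ultimately show ?thesis by (intro that)
qed

lemma norm_storm_next_x_le:
  assumes "\<eta> > 0" "\<epsilon> > 0"
  shows "norm (storm_next_x \<eta> \<epsilon> x F - x) \<le> \<eta> * \<epsilon>"
proof -
  obtain \<gamma> where \<gamma>: "storm_next_x \<eta> \<epsilon> x F = x - (\<gamma> * \<eta>) *\<^sub>R F" "0 \<le> \<gamma>" "\<gamma> * norm F \<le> \<epsilon>"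
    using storm_next_x_cases[OF assms] by metis
  then have "norm (storm_next_x \<eta> \<epsilon> x F - x) = \<eta> * (\<gamma> * norm F)"
    using assms by simp
  also have "\<dots> \<le> \<eta> * \<epsilon>" using \<gamma>(3) assms by (intro mult_left_mono) auto
  finally show ?thesis .
qed

text \<open>
  The error of the direction \<open>F\<close> costs only \<open>\<eta> * \<epsilon>\<close> times its norm, because the
  step is not longer than \<open>\<eta> * \<epsilon>\<close>. The quadratic term of the upper bound takes at most
  a quarter of the decrease, because \<open>\<gamma> \<le> 1 / 2\<close>.
\<close>

lemma descent_step:
  assumes eta: "\<eta> > 0" and eps: "\<epsilon> > 0"
    and upper: "\<And>x y. h y \<le> h x + D x \<bullet> (y - x) + (1 / \<eta>) / 2 * (norm (y - x))\<^sup>2"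
  shows "3 / 4 * \<eta> * \<epsilon> * norm F
         \<le> h x - h (storm_next_x \<eta> \<epsilon> x F) + 3 / 2 * \<eta> * \<epsilon>\<^sup>2 + \<eta> * \<epsilon> * norm (F - D x)"
proof -
  obtain \<gamma> where \<gamma>: "storm_next_x \<eta> \<epsilon> x F = x - (\<gamma> * \<eta>) *\<^sub>R F" "0 \<le> \<gamma>" "\<gamma> \<le> 1 / 2"
    "\<gamma> * norm F \<le> \<epsilon>" "\<epsilon> * norm F - 2 * \<epsilon>\<^sup>2 \<le> \<gamma> * (norm F)\<^sup>2"
    using storm_next_x_cases[OF eta eps] by metis
  let ?y = "storm_next_x \<eta> \<epsilon> x F"
  have "D x \<bullet> (?y - x) = (\<gamma> * \<eta>) * ((F - D x) \<bullet> F) - (\<gamma> * \<eta>) * (norm F)\<^sup>2"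
    by (simp add: \<gamma>(1) power2_norm_eq_inner inner_diff_left algebra_simps)
  moreover have "(\<gamma> * \<eta>) * ((F - D x) \<bullet> F) \<le> (\<gamma> * \<eta>) * (norm (F - D x) * norm F)"
    using \<gamma> eta by (intro mult_left_mono norm_cauchy_schwarz) auto
  moreover have "(\<gamma> * \<eta>) * (norm (F - D x) * norm F) \<le> \<eta> * \<epsilon> * norm (F - D x)"
    using mult_right_mono[OF \<gamma>(4), of "\<eta> * norm (F - D x)"] eta by (simp add: algebra_simps)
  moreover have "(1 / \<eta>) / 2 * (norm (?y - x))\<^sup>2 \<le> \<gamma> * \<eta> * (norm F)\<^sup>2 / 4"
  proof -
    have "(1 / \<eta>) / 2 * (norm (?y - x))\<^sup>2 = \<gamma> * (\<gamma> * (\<eta> * (norm F)\<^sup>2)) / 2"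
      using eta \<gamma>(2) by (simp add: \<gamma>(1) power_mult_distrib power2_eq_square abs_mult)
    also have "\<dots> \<le> 1 / 2 * (\<gamma> * (\<eta> * (norm F)\<^sup>2)) / 2"
      using \<gamma> eta by (intro divide_right_mono mult_right_mono) auto
    finally show ?thesis by simp
  qed
  moreover have "3 / 4 * \<eta> * (\<epsilon> * norm F - 2 * \<epsilon>\<^sup>2) \<le> 3 / 4 * \<eta> * (\<gamma> * (norm F)\<^sup>2)"
    using \<gamma>(5) eta by (intro mult_left_mono) auto
  moreover have "3 / 4 * \<eta> * (\<epsilon> * norm F - 2 * \<epsilon>\<^sup>2) = 3 / 4 * \<eta> * \<epsilon> * norm F - 3 / 2 * \<eta> * \<epsilon>\<^sup>2"
    "3 / 4 * \<eta> * (\<gamma> * (norm F)\<^sup>2) = 3 / 4 * (\<gamma> * \<eta> * (norm F)\<^sup>2)"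
    by (simp_all add: algebra_simps)
  ultimately show ?thesis using upper[of ?y x] by linarith
qed

section \<open>The law of a single state\<close>

(* Steps are used only through their form as momentum updates. *)
declare storm_step.simps [simp del]

text \<open>
  The average over the uniformly drawn output time involves only the laws of single states, and
  these form a Markov chain.
\<close>

primrec state_law ::
  "(nat \<Rightarrow> real ^ 'l \<Rightarrow> real) \<Rightarrow> nat \<Rightarrow> (nat \<Rightarrow> real ^ 'd \<Rightarrow> real ^ 'l) \<Rightarrow> nat \<Rightarrow> real ^ 'd \<Rightarrow>
   real \<Rightarrow> real \<Rightarrow> storm_params \<Rightarrow> nat \<Rightarrow> ('d, 'l) storm_state pmf" where
  "state_law f n g m x0 \<eta> \<epsilon> p 0 = storm_init f n g m x0 p"
| "state_law f n g m x0 \<eta> \<epsilon> p (Suc k) =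
     state_law f n g m x0 \<eta> \<epsilon> p k \<bind> storm_step f n g m \<eta> \<epsilon> p"

lemma length_storm_run:
  "ss \<in> set_pmf (storm_run f n g m x0 \<eta> \<epsilon> p k) \<Longrightarrow> length ss = Suc k"
  by (induction k arbitrary: ss) auto

lemma storm_run_marginal:
  "t \<le> k \<Longrightarrow>
   map_pmf (\<lambda>ss. ss ! t) (storm_run f n g m x0 \<eta> \<epsilon> p k) = state_law f n g m x0 \<eta> \<epsilon> p t"
proof (induction k arbitrary: t)
  case 0
  then show ?case by (simp add: pmf.map_comp o_def)
next
  case (Suc k)
  let ?R = "storm_run f n g m x0 \<eta> \<epsilon> p k" and ?S = "storm_step f n g m \<eta> \<epsilon> p"
  have eq: "map_pmf (\<lambda>ss. ss ! t) (storm_run f n g m x0 \<eta> \<epsilon> p (Suc k))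
        = ?R \<bind> (\<lambda>ss. ?S (last ss) \<bind> (\<lambda>s. return_pmf ((ss @ [s]) ! t)))"
    by (simp add: map_bind_pmf)
  show ?case
  proof (cases "t = Suc k")
    case True
    have "?R \<bind> (\<lambda>ss. ?S (last ss) \<bind> (\<lambda>s. return_pmf ((ss @ [s]) ! t)))
        = ?R \<bind> (\<lambda>ss. ?S (ss ! k))"
    proof (rule bind_pmf_cong[OF refl])
      fix ss assume "ss \<in> set_pmf ?R"
      then have len: "length ss = Suc k" by (rule length_storm_run)
      then have "last ss = ss ! k" by (metis diff_Suc_1 last_conv_nth list.size(3) nat.distinct(1))
      then show "?S (last ss) \<bind> (\<lambda>s. return_pmf ((ss @ [s]) ! t)) = ?S (ss ! k)"
        using True len by (simp add: nth_append bind_return_pmf')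
    qed
    also have "\<dots> = map_pmf (\<lambda>ss. ss ! k) ?R \<bind> ?S"
      by (simp add: bind_map_pmf)
    finally show ?thesis using True eq Suc.IH[of k] by simp
  next
    case False
    have "?R \<bind> (\<lambda>ss. ?S (last ss) \<bind> (\<lambda>s. return_pmf ((ss @ [s]) ! t)))
        = ?R \<bind> (\<lambda>ss. return_pmf (ss ! t))"
    proof (rule bind_pmf_cong[OF refl])
      fix ss assume "ss \<in> set_pmf ?R"
      then have "length ss = Suc k" by (rule length_storm_run)
      then show "?S (last ss) \<bind> (\<lambda>s. return_pmf ((ss @ [s]) ! t)) = return_pmf (ss ! t)"
        using False Suc.prems by (simp add: nth_append)
    qed
    then show ?thesis using False Suc eq by (simp add: map_pmf_def)
  qed
qed

lemma storm_step_eq_momentum_updates: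
  "storm_step f n g m \<eta> \<epsilon> p (x, gt, Gt, Ft) =
     (let x' = storm_next_x \<eta> \<epsilon> x Ft;
          g' = (\<lambda>bg. momentum_update (a_g p) gt bg (\<lambda>j. g j x) (\<lambda>j. g j x'));
          G' = (\<lambda>bdg. momentum_update (a_dg p) Gt bdg (\<lambda>j. jac (g j) x) (\<lambda>j. jac (g j) x'))
      in minibatch (B_g p) m \<bind> (\<lambda>bg. minibatch (B_dg p) m \<bind> (\<lambda>bdg. minibatch (B_f p) n \<bind> (\<lambda>bf.
           return_pmf (x', g' bg, G' bdg,
             momentum_update (a_Phi p) Ft bf (\<lambda>i. transpose Gt *v grad (f i) gt)
               (\<lambda>i. transpose (G' bdg) *v grad (f i) (g' bg)))))))"
  by (simp add: storm_step.simps Let_def momentum_update_def batch_avg_eq_sample_mean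
      sample_mean_linear[OF matrix_vector_mul_linear])

lemma finite_storm_init:
  assumes "n \<ge> 1" "m \<ge> 1"
  shows "finite (set_pmf (storm_init f n g m x0 p))"
  using assms by (simp add: storm_init_def Let_def finite_minibatch)

lemma finite_storm_step:
  assumes "n \<ge> 1" "m \<ge> 1"
  shows "finite (set_pmf (storm_step f n g m \<eta> \<epsilon> p s))"
  using assms by (cases s) (simp add: storm_step.simps Let_def finite_minibatch)

lemma finite_state_law:
  assumes "n \<ge> 1" "m \<ge> 1"
  shows "finite (set_pmf (state_law f n g m x0 \<eta> \<epsilon> p k))"
  by (induction k) (auto simp: finite_storm_init[OF assms] finite_storm_step[OF assms])

lemma finite_storm_run:
  assumes "n \<ge> 1" "m \<ge> 1"
  shows "finite (set_pmf (storm_run f n g m x0 \<eta> \<epsilon> p k))"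
  by (induction k) (auto simp: finite_storm_init[OF assms] finite_storm_step[OF assms])

lemma expectation_storm_output:
  fixes h :: "real ^ 'd \<Rightarrow> real" and f :: "nat \<Rightarrow> real ^ 'l \<Rightarrow> real"
  assumes "n \<ge> 1" "m \<ge> 1" and T: "iters p > 0"
  shows "measure_pmf.expectation (storm_output f n g m x0 \<eta> \<epsilon> p) h
     = (\<Sum>t<iters p. measure_pmf.expectation (state_law f n g m x0 \<eta> \<epsilon> p t) (\<lambda>s. h (fst s)))
       / real (iters p)"
proof -
  let ?R = "storm_run f n g m x0 \<eta> \<epsilon> p (iters p)"
  have nonempty: "{..<iters p} \<noteq> {}" using T by auto
  have fin: "finite (set_pmf ?R)" using assms by (intro finite_storm_run)
  have "measure_pmf.expectation (storm_output f n g m x0 \<eta> \<epsilon> p) h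
      = measure_pmf.expectation ?R (\<lambda>ss. (\<Sum>t<iters p. h (fst (ss ! t))) / real (iters p))"
    using nonempty fin
    by (simp add: storm_output_def expectation_bind_finite integral_pmf_of_set)
  also have "\<dots> = (\<Sum>t<iters p. measure_pmf.expectation ?R (\<lambda>ss. h (fst (ss ! t)))) / real (iters p)"
    by (simp add: integral_sum integrable_measure_pmf_finite fin)
  also have "\<dots> = (\<Sum>t<iters p. measure_pmf.expectation
      (map_pmf (\<lambda>ss. ss ! t) ?R) (\<lambda>s. h (fst s))) / real (iters p)"
    by simp
  finally show ?thesis by (simp add: storm_run_marginal del: integral_map_pmf)
qed

section \<open>The compositional problem\<close>

locale compositional_problem =
  fixes f :: "nat \<Rightarrow> real ^ 'l \<Rightarrow> real"
    and g :: "nat \<Rightarrow> real ^ 'd \<Rightarrow> real ^ 'l"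
    and n m :: nat
    and \<Phi> :: "real ^ 'd \<Rightarrow> real"
    and \<Phi>low :: real
    and L\<^sub>f L\<^sub>g L\<^sub>\<Phi> M\<^sub>f M\<^sub>g H\<^sub>1 H\<^sub>2 H\<^sub>3 :: real
  assumes n: "n \<ge> 1" and m: "m \<ge> 1"
    and Phi: "\<And>x. \<Phi> x = avg n f (avg m g x)"
    and f_diff: "\<And>i y. i \<in> {1..n} \<Longrightarrow> f i differentiable (at y)"
    and g_diff: "\<And>j x. j \<in> {1..m} \<Longrightarrow> g j differentiable (at x)"
    and Phi_ge: "\<And>x. \<Phi>low \<le> \<Phi> x"
    and pos: "L\<^sub>f > 0" "L\<^sub>g > 0" "L\<^sub>\<Phi> > 0" "M\<^sub>f > 0" "M\<^sub>g > 0" "H\<^sub>1 > 0" "H\<^sub>2 > 0" "H\<^sub>3 > 0"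
    and smooth_g: "\<And>j x x'. j \<in> {1..m} \<Longrightarrow>
          norm (jac (g j) x - jac (g j) x') \<le> L\<^sub>g * norm (x - x')"
    and smooth_f: "\<And>i y y'. i \<in> {1..n} \<Longrightarrow>
          norm (grad (f i) y - grad (f i) y') \<le> L\<^sub>f * norm (y - y')"
    and smooth_Phi: "\<And>i j x x'. i \<in> {1..n} \<Longrightarrow> j \<in> {1..m} \<Longrightarrow>
          norm (transpose (jac (g j) x) *v grad (f i) (avg m g x)
                - transpose (jac (g j) x') *v grad (f i) (avg m g x')) \<le> L\<^sub>\<Phi> * norm (x - x')"
    and bound_g: "\<And>j x. j \<in> {1..m} \<Longrightarrow> onorm ((*v) (jac (g j) x)) \<le> M\<^sub>g"
    and bound_f: "\<And>i y. i \<in> {1..n} \<Longrightarrow> norm (grad (f i) y) \<le> M\<^sub>f"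
    and var_f: "\<And>y. measure_pmf.expectation (uniform_index n)
          (\<lambda>i. (norm (grad (f i) y - grad (avg n f) y))\<^sup>2) \<le> H\<^sub>1"
    and var_dg: "\<And>x. measure_pmf.expectation (uniform_index m)
          (\<lambda>j. (norm (jac (g j) x - jac (avg m g) x))\<^sup>2) \<le> H\<^sub>2"
    and var_g: "\<And>x. measure_pmf.expectation (uniform_index m)
          (\<lambda>j. (norm (g j x - avg m g x))\<^sup>2) \<le> H\<^sub>3"
begin

definition g_mean :: "real ^ 'd \<Rightarrow> real ^ 'l" where
  "g_mean x = index_mean m (\<lambda>j. g j x)"

definition dg_mean :: "real ^ 'd \<Rightarrow> real ^ 'd ^ 'l" where
  "dg_mean x = index_mean m (\<lambda>j. jac (g j) x)"

definition df_mean :: "real ^ 'l \<Rightarrow> real ^ 'l" where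
  "df_mean y = index_mean n (\<lambda>i. grad (f i) y)"

definition dPhi :: "real ^ 'd \<Rightarrow> real ^ 'd" where
  "dPhi x = transpose (dg_mean x) *v df_mean (g_mean x)"

definition \<sigma>\<^sub>g :: real where "\<sigma>\<^sub>g = sqrt (real m * H\<^sub>3)"
definition \<sigma>\<^sub>G :: real where "\<sigma>\<^sub>G = sqrt (real m * H\<^sub>2)"
definition \<sigma>\<^sub>f :: real where "\<sigma>\<^sub>f = sqrt (real n * H\<^sub>1)"

lemma sigma_nonneg: "\<sigma>\<^sub>g \<ge> 0" "\<sigma>\<^sub>G \<ge> 0" "\<sigma>\<^sub>f \<ge> 0"
  using pos by (simp_all add: \<sigma>\<^sub>g_def \<sigma>\<^sub>G_def \<sigma>\<^sub>f_def)

lemma avg_g: "avg m g = g_mean"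
  by (rule ext) (simp add: g_mean_def avg_eq_index_mean)

lemma has_derivative_g_mean: "(g_mean has_derivative (\<lambda>v. dg_mean x *v v)) (at x)"
  using has_derivative_avg_jac[of m g x] g_diff unfolding avg_g dg_mean_def by blast

lemma GDERIV_avg_f: "GDERIV (avg n f) y :> df_mean y"
  unfolding df_mean_def using f_diff by (intro GDERIV_avg GDERIV_grad)

lemma GDERIV_Phi: "GDERIV \<Phi> x :> dPhi x"
proof -
  have "((\<lambda>x. avg n f (g_mean x)) has_derivative (\<lambda>v. (dg_mean x *v v) \<bullet> df_mean (g_mean x))) (at x)"
    by (rule has_derivative_compose[OF has_derivative_g_mean GDERIV_avg_f[unfolded gderiv_def]])
  moreover have "\<Phi> = (\<lambda>x. avg n f (g_mean x))" using Phi avg_g by auto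
  moreover have "(dg_mean x *v v) \<bullet> df_mean (g_mean x) = v \<bullet> dPhi x" for v
    unfolding dPhi_def
    by (metis dot_lmul_matrix inner_commute transpose_matrix_vector)
  ultimately show ?thesis by (simp add: gderiv_def)
qed

lemma grad_Phi: "grad \<Phi> x = dPhi x"
  by (rule grad_eq[OF GDERIV_Phi])

text \<open>
  In this form the Lipschitz bound for the products of single Jacobians and gradients passes to the
  gradient of the composition.
\<close>

lemma dPhi_eq_double_mean:
  "dPhi x = index_mean m (\<lambda>j. index_mean n (\<lambda>i. transpose (jac (g j) x) *v grad (f i) (g_mean x)))"
  unfolding dPhi_def dg_mean_def index_mean_linear[OF linear_transpose_apply]
  unfolding df_mean_def index_mean_linear[OF matrix_vector_mul_linear] ..

lemma dPhi_lipschitz: "norm (dPhi x - dPhi y) \<le> L\<^sub>\<Phi> * norm (x - y)"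
  unfolding dPhi_eq_double_mean index_mean_diff[symmetric]
  using smooth_Phi[unfolded avg_g] by (intro norm_index_mean_le n m)

lemma deviation_g: "j \<in> {1..m} \<Longrightarrow> norm (g j x - index_mean m (\<lambda>j. g j x)) \<le> \<sigma>\<^sub>g"
  unfolding \<sigma>\<^sub>g_def using pos var_g[of x, unfolded avg_g g_mean_def]
  by (intro deviation_le_of_variance_le[where u = "\<lambda>j. g j x"] m) auto

lemma deviation_dg: "j \<in> {1..m} \<Longrightarrow> norm (jac (g j) x - index_mean m (\<lambda>j. jac (g j) x)) \<le> \<sigma>\<^sub>G"
  unfolding \<sigma>\<^sub>G_def
  using pos var_dg[of x, unfolded avg_g jac_eq[OF has_derivative_g_mean], unfolded dg_mean_def]
  by (intro deviation_le_of_variance_le[where u = "\<lambda>j. jac (g j) x"] m) auto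

lemma deviation_df: "i \<in> {1..n} \<Longrightarrow> norm (grad (f i) y - df_mean y) \<le> \<sigma>\<^sub>f"
  unfolding \<sigma>\<^sub>f_def
  using pos var_f[of y, unfolded grad_eq[OF GDERIV_avg_f]]
  by (intro deviation_le_of_variance_le[where u = "\<lambda>i. grad (f i) y"] n) auto

lemma g_lipschitz:
  assumes "j \<in> {1..m}"
  shows "norm (g j x - g j x') \<le> M\<^sub>g * norm (x - x')"
  using g_diff[OF assms] bound_g[OF assms]
  by (intro differentiable_bound[of UNIV "g j" "\<lambda>x v. jac (g j) x *v v"])
     (auto simp: jacobian_works)

lemma norm_dg_mean_transpose_apply_le: "norm (transpose (dg_mean x) *v y) \<le> M\<^sub>g * norm y"
  unfolding dg_mean_def index_mean_linear[OF linear_transpose_apply]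
proof (rule norm_index_mean_le[OF m])
  fix j assume j: "j \<in> {1..m}"
  have "norm (jac (g j) x *v v) \<le> M\<^sub>g * norm v" for v
    using onorm[OF matrix_vector_mul_bounded_linear, of "jac (g j) x" v] bound_g[OF j, of x]
    by (meson mult_right_mono norm_ge_zero order_trans)
  then show "norm (transpose (jac (g j) x) *v y) \<le> M\<^sub>g * norm y"
    by (rule norm_transpose_apply_le)
qed

lemma norm_df_mean_le: "norm (df_mean y) \<le> M\<^sub>f"
  unfolding df_mean_def using bound_f by (intro norm_index_mean_le n)

lemma df_mean_lipschitz: "norm (df_mean y - df_mean y') \<le> L\<^sub>f * norm (y - y')"
  unfolding df_mean_def index_mean_diff[symmetric] using smooth_f by (intro norm_index_mean_le n)

end

section \<open>Constants independent of the precision\<close>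

text \<open>
  The constants \<open>c\<close> and \<open>C\<close> are those hidden in the rates of the parameters. Every
  quantity defined here depends on them and on the data of the problem, but not on the precision, so
  that it can serve as a constant in the final estimate. Surely, \<open>E\<^sub>g\<close> and \<open>E\<^sub>G\<close>
  bound the errors of the estimators of \<open>g\<close> and of its Jacobian, and \<open>D\<^sub>g\<close> and
  \<open>D\<^sub>G\<close> times the precision bound their movements in one step. The operator norm of the Jacobian
  estimator is at most \<open>K\<^sub>G\<close>, and the components that the gradient estimator tracks move by at
  most \<open>D\<^sub>F\<close> times the precision. For an estimator whose components deviate from their mean by
  \<open>\<sigma>\<close>, and by \<open>s\<close> at the start, and move by \<open>D\<close> times the precision, the mean
  square error averaged over the run is at most \<open>mean_square_rate s \<sigma> D\<close> times the square of
  the precision.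
\<close>

locale rate_constants = compositional_problem f g n m \<Phi> \<Phi>low L\<^sub>f L\<^sub>g L\<^sub>\<Phi> M\<^sub>f M\<^sub>g H\<^sub>1 H\<^sub>2 H\<^sub>3
  for f :: "nat \<Rightarrow> real ^ 'l \<Rightarrow> real"
    and g :: "nat \<Rightarrow> real ^ 'd \<Rightarrow> real ^ 'l"
    and n m :: nat
    and \<Phi> :: "real ^ 'd \<Rightarrow> real"
    and \<Phi>low L\<^sub>f L\<^sub>g L\<^sub>\<Phi> M\<^sub>f M\<^sub>g H\<^sub>1 H\<^sub>2 H\<^sub>3 :: real +
  fixes c C :: real
  assumes c: "c > 0" and C: "C > 0"
begin

definition \<eta> :: real where "\<eta> = 1 / L\<^sub>\<Phi>"

definition E\<^sub>g :: real where "E\<^sub>g = \<sigma>\<^sub>g + 2 * (M\<^sub>g * \<eta>) / c"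
definition E\<^sub>G :: real where "E\<^sub>G = \<sigma>\<^sub>G + 2 * (L\<^sub>g * \<eta>) / c"
definition K\<^sub>G :: real where "K\<^sub>G = E\<^sub>G + M\<^sub>g"
definition D\<^sub>g :: real where "D\<^sub>g = C * (E\<^sub>g + \<sigma>\<^sub>g) + M\<^sub>g * \<eta>"
definition D\<^sub>G :: real where "D\<^sub>G = C * (E\<^sub>G + \<sigma>\<^sub>G) + L\<^sub>g * \<eta>"
definition D\<^sub>F :: real where "D\<^sub>F = D\<^sub>G * M\<^sub>f + K\<^sub>G * (L\<^sub>f * D\<^sub>g)"

definition noise_level :: "real \<Rightarrow> real \<Rightarrow> real" where
  "noise_level \<sigma> D = C * \<sigma> + 2 * D"

definition mean_square_rate :: "real \<Rightarrow> real \<Rightarrow> real \<Rightarrow> real" where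
  "mean_square_rate s \<sigma> D = s\<^sup>2 / c ^ 3 + (noise_level \<sigma> D)\<^sup>2 / c\<^sup>2"

definition error_rate :: real where
  "error_rate = (mean_square_rate (K\<^sub>G * \<sigma>\<^sub>f) (K\<^sub>G * \<sigma>\<^sub>f) D\<^sub>F + 1) / 2
     + M\<^sub>f * ((mean_square_rate \<sigma>\<^sub>G \<sigma>\<^sub>G (L\<^sub>g * \<eta>) + 1) / 2)
     + M\<^sub>g * L\<^sub>f * ((mean_square_rate \<sigma>\<^sub>g \<sigma>\<^sub>g (M\<^sub>g * \<eta>) + 1) / 2)"

lemma eta_pos: "\<eta> > 0" using pos by (simp add: \<eta>_def)

lemma constants_nonneg:
  "E\<^sub>g \<ge> 0" "E\<^sub>G \<ge> 0" "K\<^sub>G \<ge> 0" "D\<^sub>g \<ge> 0" "D\<^sub>G \<ge> 0" "D\<^sub>F \<ge> 0"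
proof -
  show *: "E\<^sub>g \<ge> 0" "E\<^sub>G \<ge> 0" using pos c eta_pos sigma_nonneg by (simp_all add: E\<^sub>g_def E\<^sub>G_def)
  show **: "K\<^sub>G \<ge> 0" "D\<^sub>g \<ge> 0" "D\<^sub>G \<ge> 0"
    using * pos c C eta_pos sigma_nonneg by (simp_all add: K\<^sub>G_def D\<^sub>g_def D\<^sub>G_def)
  show "D\<^sub>F \<ge> 0" using ** pos by (simp add: D\<^sub>F_def)
qed

lemma quadratic_bound_Phi: "\<Phi> y \<le> \<Phi> x + dPhi x \<bullet> (y - x) + (1 / \<eta>) / 2 * (norm (y - x))\<^sup>2"
  using quadratic_upper_bound[OF GDERIV_Phi dPhi_lipschitz] by (simp add: \<eta>_def)

definition err\<^sub>g :: "('d::finite, 'l::finite) storm_state \<Rightarrow> real" where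
  "err\<^sub>g s = norm (fst (snd s) - g_mean (fst s))"

definition err\<^sub>G :: "('d::finite, 'l::finite) storm_state \<Rightarrow> real" where
  "err\<^sub>G s = norm (fst (snd (snd s)) - dg_mean (fst s))"

definition err\<^sub>F :: "('d::finite, 'l::finite) storm_state \<Rightarrow> real" where
  "err\<^sub>F s = norm (snd (snd (snd s)) - transpose (fst (snd (snd s))) *v df_mean (fst (snd s)))"

text \<open>
  The control that holds surely and not only in mean. The estimator of the gradient tracks a product
  of the other two estimators, and only sure bounds on these keep that product and its movement
  under control.
\<close>

definition tame :: "('d::finite, 'l::finite) storm_state \<Rightarrow> bool" where
  "tame s \<longleftrightarrow> err\<^sub>g s \<le> E\<^sub>g \<and> err\<^sub>G s \<le> E\<^sub>G"

lemma norm_transpose_estimator_le: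
  assumes "norm (G - dg_mean x) \<le> E\<^sub>G"
  shows "norm (transpose G *v y) \<le> K\<^sub>G * norm y"
proof -
  have "transpose G *v y = transpose (G - dg_mean x) *v y + transpose (dg_mean x) *v y"
    using linear_diff[OF linear_transpose_apply, of G "dg_mean x" y] by simp
  then have "norm (transpose G *v y) \<le> norm (G - dg_mean x) * norm y + M\<^sub>g * norm y"
    using norm_transpose_apply_le_norm[of "G - dg_mean x" y] norm_dg_mean_transpose_apply_le[of x y]
      norm_triangle_ineq[of "transpose (G - dg_mean x) *v y" "transpose (dg_mean x) *v y"] by simp
  also have "\<dots> \<le> K\<^sub>G * norm y"
    unfolding K\<^sub>G_def distrib_right using assms by (intro add_mono mult_right_mono) auto
  finally show ?thesis .
qed

lemma df_mean_transpose:
  "transpose A *v df_mean z = index_mean n (\<lambda>i. transpose A *v grad (f i) z)"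
  unfolding df_mean_def by (rule index_mean_linear[OF matrix_vector_mul_linear])

lemma transpose_deviation_le:
  assumes "norm (A - dg_mean x) \<le> E\<^sub>G" "i \<in> {1..n}"
  shows "norm (transpose A *v grad (f i) y - transpose A *v df_mean y) \<le> K\<^sub>G * \<sigma>\<^sub>f"
proof -
  have "norm (transpose A *v (grad (f i) y - df_mean y)) \<le> K\<^sub>G * norm (grad (f i) y - df_mean y)"
    using assms(1) by (rule norm_transpose_estimator_le)
  also have "\<dots> \<le> K\<^sub>G * \<sigma>\<^sub>f"
    using deviation_df[OF assms(2)] constants_nonneg by (intro mult_left_mono) auto
  finally show ?thesis by (simp add: matrix_vector_mult_diff_distrib)
qed

text \<open>
  The direction is compared with the gradient in three steps: first its own target, the product
  formed from the other two estimators, then the true Jacobian in place of the estimated one, and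
  last the true value of \<open>g\<close>.
\<close>

lemma total_error_le:
  "norm (snd (snd (snd s)) - dPhi (fst s)) \<le> err\<^sub>F s + M\<^sub>f * err\<^sub>G s + M\<^sub>g * L\<^sub>f * err\<^sub>g s"
proof -
  obtain x y G F where s: "s = (x, y, G, F)" by (cases s)
  have eq: "F - dPhi x = (F - transpose G *v df_mean y)
      + (transpose (G - dg_mean x) *v df_mean y
      + transpose (dg_mean x) *v (df_mean y - df_mean (g_mean x)))"
    using linear_diff[OF linear_transpose_apply, of G "dg_mean x" "df_mean y"]
    by (simp add: dPhi_def matrix_vector_mult_diff_distrib)
  have b1: "norm (transpose (G - dg_mean x) *v df_mean y) \<le> M\<^sub>f * err\<^sub>G s"
    using norm_transpose_apply_le_norm[of "G - dg_mean x" "df_mean y"]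
      mult_left_mono[OF norm_df_mean_le[of y], of "norm (G - dg_mean x)"]
    by (simp add: s err\<^sub>G_def mult.commute)
  have b2: "norm (transpose (dg_mean x) *v (df_mean y - df_mean (g_mean x)))
      \<le> M\<^sub>g * L\<^sub>f * err\<^sub>g s"
    using order_trans[OF norm_dg_mean_transpose_apply_le[of x "df_mean y - df_mean (g_mean x)"]
      mult_left_mono[OF df_mean_lipschitz[of y "g_mean x"], of M\<^sub>g]] pos
    by (simp add: s err\<^sub>g_def mult.assoc)
  have "norm (F - dPhi x)
      \<le> norm (F - transpose G *v df_mean y) + M\<^sub>f * err\<^sub>G s + M\<^sub>g * L\<^sub>f * err\<^sub>g s"
    unfolding eq
    using norm_triangle_ineq[of "F - transpose G *v df_mean y"
        "transpose (G - dg_mean x) *v df_mean y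
         + transpose (dg_mean x) *v (df_mean y - df_mean (g_mean x))"]
      norm_triangle_ineq[of "transpose (G - dg_mean x) *v df_mean y"
        "transpose (dg_mean x) *v (df_mean y - df_mean (g_mean x))"] b1 b2
    by linarith
  then show ?thesis by (simp add: s err\<^sub>F_def)
qed

end

section \<open>One step at a fixed precision\<close>

text \<open>
  A single run at a fixed precision, with the asymptotic rates of the parameters replaced by the
  inequalities that they mean.
\<close>

locale calibrated_run = rate_constants f g n m \<Phi> \<Phi>low L\<^sub>f L\<^sub>g L\<^sub>\<Phi> M\<^sub>f M\<^sub>g H\<^sub>1 H\<^sub>2 H\<^sub>3 c C
  for f :: "nat \<Rightarrow> real ^ 'l \<Rightarrow> real"
    and g :: "nat \<Rightarrow> real ^ 'd \<Rightarrow> real ^ 'l"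
    and n m :: nat
    and \<Phi> :: "real ^ 'd \<Rightarrow> real"
    and \<Phi>low L\<^sub>f L\<^sub>g L\<^sub>\<Phi> M\<^sub>f M\<^sub>g H\<^sub>1 H\<^sub>2 H\<^sub>3 c C :: real +
  fixes \<epsilon> :: real and p :: storm_params and x0 :: "real ^ 'd"
  assumes eps: "\<epsilon> > 0"
    and a_range: "a_g p < 1" "a_dg p < 1" "a_Phi p < 1"
    and a_lower: "c * \<epsilon> \<le> a_g p" "c * \<epsilon> \<le> a_dg p" "c * \<epsilon> \<le> a_Phi p"
    and a_upper: "a_g p \<le> C * \<epsilon>" "a_dg p \<le> C * \<epsilon>" "a_Phi p \<le> C * \<epsilon>"
    and B_lower: "c / \<epsilon> \<le> real (B_g p)" "c / \<epsilon> \<le> real (B_dg p)" "c / \<epsilon> \<le> real (B_f p)"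
    and S_lower: "c / \<epsilon> \<le> real (S_g p)" "c / \<epsilon> \<le> real (S_dg p)" "c / \<epsilon> \<le> real (S_f p)"
    and T_lower: "c / \<epsilon>\<^sup>2 \<le> real (iters p)"
begin

lemma a_pos: "a_g p > 0" "a_dg p > 0" "a_Phi p > 0"
  using a_lower c eps by (meson less_le_trans mult_pos_pos)+

lemma pos_of_lower_bound:
  assumes "c / \<epsilon> \<le> real B"
  shows "B > 0"
proof -
  have "0 < c / \<epsilon>" using c eps by simp
  then have "0 < real B" using assms by linarith
  then show ?thesis by simp
qed

lemma iters_pos: "iters p > 0"
proof -
  have "0 < c / \<epsilon>\<^sup>2" using c eps by simp
  then have "0 < real (iters p)" using T_lower by linarith
  then show ?thesis by simp
qed

lemma batch_nonempty:
  assumes "c / \<epsilon> \<le> real B" "N \<ge> 1" "b \<in> set_pmf (minibatch B N)"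
  shows "b \<noteq> []" "b \<in> lists {1..N}"
  using assms pos_of_lower_bound[OF assms(1)] by (auto simp: set_minibatch)

lemma sample_variance_le:
  assumes "c / \<epsilon> \<le> real B"
  shows "\<sigma>\<^sup>2 / real B \<le> \<sigma>\<^sup>2 * \<epsilon> / c"
proof -
  have "\<sigma>\<^sup>2 / real B \<le> \<sigma>\<^sup>2 / (c / \<epsilon>)"
    using assms c eps by (intro divide_left_mono) (auto simp: pos_of_lower_bound)
  then show ?thesis by simp
qed

text \<open>
  Here the rates meet: a noise of the order \<open>\<epsilon>\<close> has a square of the order
  \<open>\<epsilon>\<^sup>2\<close>, and a batch of size \<open>1 / \<epsilon>\<close> gains a further factor \<open>\<epsilon>\<close>.
\<close>

lemma noise_variance_le:
  assumes a: "0 < a" "a \<le> C * \<epsilon>" and B: "c / \<epsilon> \<le> real B" and nn: "\<sigma> \<ge> 0" "D \<ge> 0"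
  shows "(a * \<sigma> + 2 * (D * \<epsilon>))\<^sup>2 / real B \<le> (noise_level \<sigma> D)\<^sup>2 * \<epsilon> ^ 3 / c"
proof -
  have "a * \<sigma> + 2 * (D * \<epsilon>) \<le> noise_level \<sigma> D * \<epsilon>"
    using mult_right_mono[OF a(2) nn(1)] by (simp add: noise_level_def algebra_simps)
  then have "(a * \<sigma> + 2 * (D * \<epsilon>))\<^sup>2 \<le> (noise_level \<sigma> D * \<epsilon>)\<^sup>2"
    using a nn eps by (intro power_mono) auto
  then have "(a * \<sigma> + 2 * (D * \<epsilon>))\<^sup>2 / real B \<le> (noise_level \<sigma> D * \<epsilon>)\<^sup>2 / real B"
    by (intro divide_right_mono) auto
  also have "\<dots> \<le> (noise_level \<sigma> D * \<epsilon>)\<^sup>2 * \<epsilon> / c" by (rule sample_variance_le[OF B])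
  also have "\<dots> = (noise_level \<sigma> D)\<^sup>2 * \<epsilon> ^ 3 / c"
    by (simp add: power_mult_distrib power2_eq_square power3_eq_cube)
  finally show ?thesis .
qed

text \<open>
  The bound \<open>\<sigma> + 2 * D / c\<close> survives a step: the momentum forgets a fraction \<open>a\<close>
  of the old error, and since \<open>a\<close> is at least \<open>c * \<epsilon>\<close>, this fraction outweighs the
  noise.
\<close>

lemma err_bound_invariant:
  assumes a: "0 < a" "a < 1" "c * \<epsilon> \<le> a" and D: "D \<ge> 0" and e: "e \<le> \<sigma> + 2 * D / c"
  shows "(1 - a) * e + (a * \<sigma> + 2 * (D * \<epsilon>)) \<le> \<sigma> + 2 * D / c"
proof -
  define q where "q = 2 * D / c"
  have "2 * (D * \<epsilon>) \<le> a * q"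
    using mult_right_mono[OF a(3), of q] D c by (simp add: q_def mult_ac)
  moreover have "(1 - a) * e \<le> (1 - a) * (\<sigma> + q)"
    using a e by (intro mult_left_mono) (auto simp: q_def)
  ultimately show ?thesis unfolding q_def[symmetric] by (simp add: algebra_simps)
qed

text \<open>
  Noise of the order \<open>\<epsilon> ^ 3\<close> per step against a contraction by \<open>1 - a\<close> leaves a mean
  square of the order \<open>\<epsilon>\<^sup>2\<close>. The initial error is only of the order \<open>\<epsilon>\<close> and
  contributes a constant to the sum, which \<open>1 / \<epsilon>\<^sup>2\<close> iterations absorb.
\<close>

lemma sum_mean_square_le:
  fixes v :: "nat \<Rightarrow> real"
  assumes a: "0 < a" "c * \<epsilon> \<le> a" and v: "\<And>k. v k \<ge> 0"
    and init: "v 0 \<le> s\<^sup>2 * \<epsilon> / c"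
    and rec: "\<And>k. v (Suc k) \<le> (1 - a) * v k + (noise_level \<sigma> D)\<^sup>2 * \<epsilon> ^ 3 / c"
  shows "(\<Sum>k<iters p. v k) \<le> real (iters p) * \<epsilon>\<^sup>2 * mean_square_rate s \<sigma> D"
proof -
  let ?r = "(noise_level \<sigma> D)\<^sup>2" and ?T = "real (iters p)"
  have T: "c \<le> ?T * \<epsilon>\<^sup>2" using T_lower eps by (simp add: divide_simps)
  have "(\<Sum>k<iters p. v k) \<le> (v 0 + ?T * (?r * \<epsilon> ^ 3 / c)) / a"
    using a v rec by (intro contraction_sum_le[where v = v])
  also have "\<dots> \<le> (s\<^sup>2 * \<epsilon> / c + ?T * (?r * \<epsilon> ^ 3 / c)) / (c * \<epsilon>)"
    using a c eps init v[of 0] by (intro frac_le add_right_mono) auto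
  also have "\<dots> = s\<^sup>2 / c ^ 3 * c + ?T * \<epsilon>\<^sup>2 * (?r / c\<^sup>2)"
    using c eps by (simp add: field_simps power2_eq_square power3_eq_cube)
  also have "\<dots> \<le> s\<^sup>2 / c ^ 3 * (?T * \<epsilon>\<^sup>2) + ?T * \<epsilon>\<^sup>2 * (?r / c\<^sup>2)"
    using T c by (intro add_right_mono mult_left_mono) auto
  also have "\<dots> = ?T * \<epsilon>\<^sup>2 * mean_square_rate s \<sigma> D"
    by (simp add: mean_square_rate_def algebra_simps)
  finally show ?thesis .
qed

end

locale tame_step = calibrated_run f g n m \<Phi> \<Phi>low L\<^sub>f L\<^sub>g L\<^sub>\<Phi> M\<^sub>f M\<^sub>g H\<^sub>1 H\<^sub>2 H\<^sub>3 c C \<epsilon> p x0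
  for f :: "nat \<Rightarrow> real ^ 'l \<Rightarrow> real"
    and g :: "nat \<Rightarrow> real ^ 'd \<Rightarrow> real ^ 'l"
    and n m :: nat
    and \<Phi> :: "real ^ 'd \<Rightarrow> real"
    and \<Phi>low L\<^sub>f L\<^sub>g L\<^sub>\<Phi> M\<^sub>f M\<^sub>g H\<^sub>1 H\<^sub>2 H\<^sub>3 c C \<epsilon> :: real
    and p :: storm_params
    and x0 :: "real ^ 'd" +
  fixes x :: "real ^ 'd" and y :: "real ^ 'l" and G :: "real ^ 'd ^ 'l" and F :: "real ^ 'd"
  assumes tame: "tame (x, y, G, F)"
begin

definition x_next :: "real ^ 'd" where
  "x_next = storm_next_x \<eta> \<epsilon> x F"

definition y_next :: "nat list \<Rightarrow> real ^ 'l" where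
  "y_next bg = momentum_update (a_g p) y bg (\<lambda>j. g j x) (\<lambda>j. g j x_next)"

definition G_next :: "nat list \<Rightarrow> real ^ 'd ^ 'l" where
  "G_next bdg = momentum_update (a_dg p) G bdg (\<lambda>j. jac (g j) x) (\<lambda>j. jac (g j) x_next)"

definition F_next :: "nat list \<Rightarrow> nat list \<Rightarrow> nat list \<Rightarrow> real ^ 'd" where
  "F_next bg bdg bf = momentum_update (a_Phi p) F bf (\<lambda>i. transpose G *v grad (f i) y)
     (\<lambda>i. transpose (G_next bdg) *v grad (f i) (y_next bg))"

lemma norm_move_x_le: "norm (x_next - x) \<le> \<eta> * \<epsilon>"
  unfolding x_next_def by (rule norm_storm_next_x_le[OF eta_pos eps])

sublocale track_g: tracking_step m "a_g p" \<sigma>\<^sub>g "M\<^sub>g * \<eta> * \<epsilon>" "\<lambda>j. g j x" "\<lambda>j. g j x_next"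
proof
  fix j assume "j \<in> {1..m}"
  then have "norm (g j x_next - g j x) \<le> M\<^sub>g * norm (x_next - x)" by (rule g_lipschitz)
  also have "\<dots> \<le> M\<^sub>g * (\<eta> * \<epsilon>)" using norm_move_x_le pos by (intro mult_left_mono) auto
  finally show "norm (g j x_next - g j x) \<le> M\<^sub>g * \<eta> * \<epsilon>" by (simp add: mult.assoc)
qed (use m a_pos a_range deviation_g in auto)

sublocale track_G: tracking_step m "a_dg p" \<sigma>\<^sub>G "L\<^sub>g * \<eta> * \<epsilon>"
  "\<lambda>j. jac (g j) x" "\<lambda>j. jac (g j) x_next"
proof
  fix j assume "j \<in> {1..m}"
  then have "norm (jac (g j) x_next - jac (g j) x) \<le> L\<^sub>g * norm (x_next - x)" by (rule smooth_g)
  also have "\<dots> \<le> L\<^sub>g * (\<eta> * \<epsilon>)" using norm_move_x_le pos by (intro mult_left_mono) auto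
  finally show "norm (jac (g j) x_next - jac (g j) x) \<le> L\<^sub>g * \<eta> * \<epsilon>" by (simp add: mult.assoc)
qed (use m a_pos a_range deviation_dg in auto)

lemma err_le: "norm (y - g_mean x) \<le> E\<^sub>g" "norm (G - dg_mean x) \<le> E\<^sub>G"
  using tame by (simp_all add: tame_def err\<^sub>g_def err\<^sub>G_def)

lemma err_y_next_le:
  assumes "bg \<noteq> []" "bg \<in> lists {1..m}"
  shows "norm (y_next bg - g_mean x_next) \<le> E\<^sub>g"
proof -
  have "norm (y_next bg - g_mean x_next)
      \<le> (1 - a_g p) * norm (y - g_mean x) + (a_g p * \<sigma>\<^sub>g + 2 * (M\<^sub>g * \<eta> * \<epsilon>))"
    unfolding y_next_def g_mean_def by (rule track_g.momentum_update_error_le[OF assms])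
  also have "\<dots> \<le> E\<^sub>g"
    unfolding E\<^sub>g_def using a_pos a_range a_lower pos eta_pos err_le[unfolded E\<^sub>g_def]
    by (intro err_bound_invariant) auto
  finally show ?thesis .
qed

lemma err_G_next_le:
  assumes "bdg \<noteq> []" "bdg \<in> lists {1..m}"
  shows "norm (G_next bdg - dg_mean x_next) \<le> E\<^sub>G"
proof -
  have "norm (G_next bdg - dg_mean x_next)
      \<le> (1 - a_dg p) * norm (G - dg_mean x) + (a_dg p * \<sigma>\<^sub>G + 2 * (L\<^sub>g * \<eta> * \<epsilon>))"
    unfolding G_next_def dg_mean_def by (rule track_G.momentum_update_error_le[OF assms])
  also have "\<dots> \<le> E\<^sub>G"
    unfolding E\<^sub>G_def using a_pos a_range a_lower pos eta_pos err_le[unfolded E\<^sub>G_def]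
    by (intro err_bound_invariant) auto
  finally show ?thesis .
qed

lemma norm_move_y_le:
  assumes "bg \<noteq> []" "bg \<in> lists {1..m}"
  shows "norm (y_next bg - y) \<le> D\<^sub>g * \<epsilon>"
proof -
  have "norm (y_next bg - y) \<le> a_g p * (norm (y - g_mean x) + \<sigma>\<^sub>g) + M\<^sub>g * \<eta> * \<epsilon>"
    unfolding y_next_def g_mean_def by (rule track_g.momentum_update_move_le[OF assms])
  also have "\<dots> \<le> (C * \<epsilon>) * (E\<^sub>g + \<sigma>\<^sub>g) + M\<^sub>g * \<eta> * \<epsilon>"
    using a_upper a_pos err_le sigma_nonneg C eps by (intro add_right_mono mult_mono) auto
  finally show ?thesis by (simp add: D\<^sub>g_def algebra_simps)
qed

lemma norm_move_G_le:
  assumes "bdg \<noteq> []" "bdg \<in> lists {1..m}"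
  shows "norm (G_next bdg - G) \<le> D\<^sub>G * \<epsilon>"
proof -
  have "norm (G_next bdg - G) \<le> a_dg p * (norm (G - dg_mean x) + \<sigma>\<^sub>G) + L\<^sub>g * \<eta> * \<epsilon>"
    unfolding G_next_def dg_mean_def by (rule track_G.momentum_update_move_le[OF assms])
  also have "\<dots> \<le> (C * \<epsilon>) * (E\<^sub>G + \<sigma>\<^sub>G) + L\<^sub>g * \<eta> * \<epsilon>"
    using a_upper a_pos err_le sigma_nonneg C eps by (intro add_right_mono mult_mono) auto
  finally show ?thesis by (simp add: D\<^sub>G_def algebra_simps)
qed

text \<open>
  The gradient estimator follows the product of the current Jacobian estimator with the gradient of
  \<open>f\<close> at the current estimate of \<open>g\<close>, not the gradient of the composition. With respect to
  this target it is an instance of the same scheme: the target moves by the order of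
  \<open>\<epsilon>\<close>, because both factors do so surely.
\<close>

lemma tracking_step_F:
  assumes bg: "bg \<noteq> []" "bg \<in> lists {1..m}" and bdg: "bdg \<noteq> []" "bdg \<in> lists {1..m}"
  shows "tracking_step n (a_Phi p) (K\<^sub>G * \<sigma>\<^sub>f) (D\<^sub>F * \<epsilon>) (\<lambda>i. transpose G *v grad (f i) y)
     (\<lambda>i. transpose (G_next bdg) *v grad (f i) (y_next bg))"
proof
  fix i assume i: "i \<in> {1..n}"
  show "norm (transpose G *v grad (f i) y - index_mean n (\<lambda>i. transpose G *v grad (f i) y))
      \<le> K\<^sub>G * \<sigma>\<^sub>f"
    unfolding df_mean_transpose[symmetric] by (rule transpose_deviation_le[OF err_le(2) i])
  show "norm (transpose (G_next bdg) *v grad (f i) (y_next bg)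
      - index_mean n (\<lambda>i. transpose (G_next bdg) *v grad (f i) (y_next bg))) \<le> K\<^sub>G * \<sigma>\<^sub>f"
    unfolding df_mean_transpose[symmetric]
    by (rule transpose_deviation_le[OF err_G_next_le[OF bdg] i])
  have "transpose (G_next bdg) *v grad (f i) (y_next bg) - transpose G *v grad (f i) y
      = transpose (G_next bdg - G) *v grad (f i) (y_next bg)
        + transpose G *v (grad (f i) (y_next bg) - grad (f i) y)"
    using linear_diff[OF linear_transpose_apply, of "G_next bdg" G "grad (f i) (y_next bg)"]
    by (simp add: matrix_vector_mult_diff_distrib)
  also have "norm \<dots> \<le> norm (transpose (G_next bdg - G) *v grad (f i) (y_next bg))
      + norm (transpose G *v (grad (f i) (y_next bg) - grad (f i) y))"
    by (rule norm_triangle_ineq)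
  also have "\<dots> \<le> norm (G_next bdg - G) * norm (grad (f i) (y_next bg))
      + K\<^sub>G * norm (grad (f i) (y_next bg) - grad (f i) y)"
    by (intro add_mono norm_transpose_apply_le_norm norm_transpose_estimator_le[OF err_le(2)])
  also have "\<dots> \<le> (D\<^sub>G * \<epsilon>) * M\<^sub>f + K\<^sub>G * (L\<^sub>f * (D\<^sub>g * \<epsilon>))"
  proof (intro add_mono mult_mono mult_left_mono)
    have "norm (grad (f i) (y_next bg) - grad (f i) y) \<le> L\<^sub>f * norm (y_next bg - y)"
      by (rule smooth_f[OF i])
    also have "\<dots> \<le> L\<^sub>f * (D\<^sub>g * \<epsilon>)" using norm_move_y_le[OF bg] pos by (intro mult_left_mono) auto
    finally show "norm (grad (f i) (y_next bg) - grad (f i) y) \<le> L\<^sub>f * (D\<^sub>g * \<epsilon>)" .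
  qed (use norm_move_G_le[OF bdg] bound_f[OF i] constants_nonneg eps in auto)
  finally show "norm (transpose (G_next bdg) *v grad (f i) (y_next bg) - transpose G *v grad (f i) y)
      \<le> D\<^sub>F * \<epsilon>"
    by (simp add: D\<^sub>F_def algebra_simps)
qed (use n a_pos a_range in auto)

abbreviation step_law :: "('d::finite, 'l::finite) storm_state pmf" where
  "step_law \<equiv> storm_step f n g m \<eta> \<epsilon> p (x, y, G, F)"

lemma step_law_eq:
  "step_law = minibatch (B_g p) m \<bind> (\<lambda>bg. minibatch (B_dg p) m \<bind> (\<lambda>bdg.
     minibatch (B_f p) n \<bind> (\<lambda>bf. return_pmf (x_next, y_next bg, G_next bdg, F_next bg bdg bf))))"
  by (simp add: storm_step_eq_momentum_updates Let_def x_next_def y_next_def G_next_def F_next_def)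

lemma expectation_step:
  fixes h :: "_ \<Rightarrow> real"
  shows "measure_pmf.expectation step_law h =
     measure_pmf.expectation (minibatch (B_g p) m) (\<lambda>bg.
       measure_pmf.expectation (minibatch (B_dg p) m) (\<lambda>bdg.
         measure_pmf.expectation (minibatch (B_f p) n) (\<lambda>bf.
           h (x_next, y_next bg, G_next bdg, F_next bg bdg bf))))"
  by (simp add: step_law_eq expectation_bind_finite finite_minibatch[OF n] finite_minibatch[OF m])

lemma step_support:
  assumes "s \<in> set_pmf step_law"
  shows "tame s"
proof -
  obtain bg bdg bf where b: "bg \<in> set_pmf (minibatch (B_g p) m)" "bdg \<in> set_pmf (minibatch (B_dg p) m)"
    and s: "s = (x_next, y_next bg, G_next bdg, F_next bg bdg bf)"
    using assms by (auto simp: step_law_eq)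
  show ?thesis
    using err_y_next_le[OF batch_nonempty[OF B_lower(1) m b(1)]]
      err_G_next_le[OF batch_nonempty[OF B_lower(2) m b(2)]]
    by (simp add: s tame_def err\<^sub>g_def err\<^sub>G_def)
qed

lemma expectation_err_g_le:
  "measure_pmf.expectation step_law (\<lambda>s. (err\<^sub>g s)\<^sup>2)
   \<le> (1 - a_g p) * (err\<^sub>g (x, y, G, F))\<^sup>2 + (noise_level \<sigma>\<^sub>g (M\<^sub>g * \<eta>))\<^sup>2 * \<epsilon> ^ 3 / c"
proof -
  have "measure_pmf.expectation step_law (\<lambda>s. (err\<^sub>g s)\<^sup>2)
      = measure_pmf.expectation (minibatch (B_g p) m) (\<lambda>bg. (norm (y_next bg - g_mean x_next))\<^sup>2)"
    by (simp add: expectation_step err\<^sub>g_def)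
  also have "\<dots> \<le> (1 - a_g p) * (norm (y - g_mean x))\<^sup>2
      + (a_g p * \<sigma>\<^sub>g + 2 * (M\<^sub>g * \<eta> * \<epsilon>))\<^sup>2 / real (B_g p)"
    unfolding y_next_def g_mean_def
    by (rule track_g.expectation_momentum_update_error_le[OF pos_of_lower_bound[OF B_lower(1)]])
  also have "(a_g p * \<sigma>\<^sub>g + 2 * (M\<^sub>g * \<eta> * \<epsilon>))\<^sup>2 / real (B_g p)
      \<le> (noise_level \<sigma>\<^sub>g (M\<^sub>g * \<eta>))\<^sup>2 * \<epsilon> ^ 3 / c"
    using a_pos a_upper B_lower sigma_nonneg pos eta_pos by (intro noise_variance_le) auto
  finally show ?thesis by (simp add: err\<^sub>g_def)
qed

lemma expectation_err_G_le:
  "measure_pmf.expectation step_law (\<lambda>s. (err\<^sub>G s)\<^sup>2)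
   \<le> (1 - a_dg p) * (err\<^sub>G (x, y, G, F))\<^sup>2 + (noise_level \<sigma>\<^sub>G (L\<^sub>g * \<eta>))\<^sup>2 * \<epsilon> ^ 3 / c"
proof -
  have "measure_pmf.expectation step_law (\<lambda>s. (err\<^sub>G s)\<^sup>2)
      = measure_pmf.expectation (minibatch (B_dg p) m) (\<lambda>bdg. (norm (G_next bdg - dg_mean x_next))\<^sup>2)"
    by (simp add: expectation_step err\<^sub>G_def)
  also have "\<dots> \<le> (1 - a_dg p) * (norm (G - dg_mean x))\<^sup>2
      + (a_dg p * \<sigma>\<^sub>G + 2 * (L\<^sub>g * \<eta> * \<epsilon>))\<^sup>2 / real (B_dg p)"
    unfolding G_next_def dg_mean_def
    by (rule track_G.expectation_momentum_update_error_le[OF pos_of_lower_bound[OF B_lower(2)]])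
  also have "(a_dg p * \<sigma>\<^sub>G + 2 * (L\<^sub>g * \<eta> * \<epsilon>))\<^sup>2 / real (B_dg p)
      \<le> (noise_level \<sigma>\<^sub>G (L\<^sub>g * \<eta>))\<^sup>2 * \<epsilon> ^ 3 / c"
    using a_pos a_upper B_lower sigma_nonneg pos eta_pos by (intro noise_variance_le) auto
  finally show ?thesis by (simp add: err\<^sub>G_def)
qed

text \<open>
  The batch for \<open>f\<close> is independent of the two other batches. The bound therefore holds
  conditionally on these, uniformly in their outcome.
\<close>

lemma expectation_err_F_le:
  "measure_pmf.expectation step_law (\<lambda>s. (err\<^sub>F s)\<^sup>2)
   \<le> (1 - a_Phi p) * (err\<^sub>F (x, y, G, F))\<^sup>2 + (noise_level (K\<^sub>G * \<sigma>\<^sub>f) D\<^sub>F)\<^sup>2 * \<epsilon> ^ 3 / c"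
    (is "_ \<le> ?r")
  unfolding expectation_step
proof (rule expectation_le_const[OF finite_minibatch[OF m]],
    rule expectation_le_const[OF finite_minibatch[OF m]])
  fix bg bdg
  assume b: "bg \<in> set_pmf (minibatch (B_g p) m)" "bdg \<in> set_pmf (minibatch (B_dg p) m)"
  interpret track_F: tracking_step n "a_Phi p" "K\<^sub>G * \<sigma>\<^sub>f" "D\<^sub>F * \<epsilon>" "\<lambda>i. transpose G *v grad (f i) y"
    "\<lambda>i. transpose (G_next bdg) *v grad (f i) (y_next bg)"
    by (intro tracking_step_F batch_nonempty[OF B_lower(1) m b(1)] batch_nonempty[OF B_lower(2) m b(2)])
  have "measure_pmf.expectation (minibatch (B_f p) n)
      (\<lambda>bf. (err\<^sub>F (x_next, y_next bg, G_next bdg, F_next bg bdg bf))\<^sup>2)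
    = measure_pmf.expectation (minibatch (B_f p) n) (\<lambda>bf. (norm (F_next bg bdg bf
        - index_mean n (\<lambda>i. transpose (G_next bdg) *v grad (f i) (y_next bg))))\<^sup>2)"
    by (simp add: err\<^sub>F_def df_mean_transpose)
  also have "\<dots> \<le> (1 - a_Phi p) * (norm (F - index_mean n (\<lambda>i. transpose G *v grad (f i) y)))\<^sup>2
      + (a_Phi p * (K\<^sub>G * \<sigma>\<^sub>f) + 2 * (D\<^sub>F * \<epsilon>))\<^sup>2 / real (B_f p)"
    unfolding F_next_def
    by (rule track_F.expectation_momentum_update_error_le[OF pos_of_lower_bound[OF B_lower(3)]])
  also have "(a_Phi p * (K\<^sub>G * \<sigma>\<^sub>f) + 2 * (D\<^sub>F * \<epsilon>))\<^sup>2 / real (B_f p)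
      \<le> (noise_level (K\<^sub>G * \<sigma>\<^sub>f) D\<^sub>F)\<^sup>2 * \<epsilon> ^ 3 / c"
    using a_pos a_upper B_lower sigma_nonneg constants_nonneg by (intro noise_variance_le) auto
  finally show "measure_pmf.expectation (minibatch (B_f p) n)
      (\<lambda>bf. (err\<^sub>F (x_next, y_next bg, G_next bdg, F_next bg bdg bf))\<^sup>2) \<le> ?r"
    by (simp add: err\<^sub>F_def df_mean_transpose)
qed

lemma expected_descent:
  "3 / 4 * \<eta> * \<epsilon> * norm F \<le> \<Phi> x - measure_pmf.expectation step_law (\<lambda>s. \<Phi> (fst s))
     + 3 / 2 * \<eta> * \<epsilon>\<^sup>2 + \<eta> * \<epsilon> * norm (F - dPhi x)"
proof -
  have "measure_pmf.expectation step_law (\<lambda>s. \<Phi> (fst s)) = \<Phi> x_next"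
    by (simp add: expectation_step)
  then show ?thesis
    unfolding x_next_def using descent_step[OF eta_pos eps quadratic_bound_Phi, of F x] by simp
qed

end

section \<open>Averaging over the run\<close>

context calibrated_run
begin

abbreviation law :: "nat \<Rightarrow> ('d::finite, 'l::finite) storm_state pmf" where
  "law k \<equiv> state_law f n g m x0 \<eta> \<epsilon> p k"

abbreviation mean :: "nat \<Rightarrow> (('d::finite, 'l::finite) storm_state \<Rightarrow> real) \<Rightarrow> real" where
  "mean k h \<equiv> measure_pmf.expectation (law k) h"

abbreviation step_mean ::
  "('d::finite, 'l::finite) storm_state \<Rightarrow>
   (('d::finite, 'l::finite) storm_state \<Rightarrow> real) \<Rightarrow> real" where
  "step_mean s h \<equiv> measure_pmf.expectation (storm_step f n g m \<eta> \<epsilon> p s) h"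

lemma finite_law: "finite (set_pmf (law k))"
  by (rule finite_state_law[OF n m])

lemma integrable_law: "integrable (law k) (h :: _ \<Rightarrow> real)"
  by (rule integrable_measure_pmf_finite[OF finite_law])

lemma mean_Suc: "mean (Suc k) h = mean k (\<lambda>s. step_mean s h)"
  by (simp add: expectation_bind_finite finite_law finite_storm_step[OF n m])

lemma one_step_estimates:
  assumes "tame s"
  shows tame_step_support: "s' \<in> set_pmf (storm_step f n g m \<eta> \<epsilon> p s) \<Longrightarrow> tame s'"
    and step_err_g: "step_mean s (\<lambda>s. (err\<^sub>g s)\<^sup>2)
      \<le> (1 - a_g p) * (err\<^sub>g s)\<^sup>2 + (noise_level \<sigma>\<^sub>g (M\<^sub>g * \<eta>))\<^sup>2 * \<epsilon> ^ 3 / c"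
    and step_err_G: "step_mean s (\<lambda>s. (err\<^sub>G s)\<^sup>2)
      \<le> (1 - a_dg p) * (err\<^sub>G s)\<^sup>2 + (noise_level \<sigma>\<^sub>G (L\<^sub>g * \<eta>))\<^sup>2 * \<epsilon> ^ 3 / c"
    and step_err_F: "step_mean s (\<lambda>s. (err\<^sub>F s)\<^sup>2)
      \<le> (1 - a_Phi p) * (err\<^sub>F s)\<^sup>2 + (noise_level (K\<^sub>G * \<sigma>\<^sub>f) D\<^sub>F)\<^sup>2 * \<epsilon> ^ 3 / c"
    and step_descent: "3 / 4 * \<eta> * \<epsilon> * norm (snd (snd (snd s)))
      \<le> \<Phi> (fst s) - step_mean s (\<lambda>s. \<Phi> (fst s)) + 3 / 2 * \<eta> * \<epsilon>\<^sup>2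
        + \<eta> * \<epsilon> * norm (snd (snd (snd s)) - dPhi (fst s))"
proof -
  obtain x y G F where s: "s = (x, y, G, F)" by (cases s)
  interpret tame_step f g n m \<Phi> \<Phi>low L\<^sub>f L\<^sub>g L\<^sub>\<Phi> M\<^sub>f M\<^sub>g H\<^sub>1 H\<^sub>2 H\<^sub>3 c C \<epsilon> p x0 x y G F
    using assms by unfold_locales (simp add: s)
  show "s' \<in> set_pmf (storm_step f n g m \<eta> \<epsilon> p s) \<Longrightarrow> tame s'"
    unfolding s by (rule step_support)
  show "step_mean s (\<lambda>s. (err\<^sub>g s)\<^sup>2)
      \<le> (1 - a_g p) * (err\<^sub>g s)\<^sup>2 + (noise_level \<sigma>\<^sub>g (M\<^sub>g * \<eta>))\<^sup>2 * \<epsilon> ^ 3 / c"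
    unfolding s by (rule expectation_err_g_le)
  show "step_mean s (\<lambda>s. (err\<^sub>G s)\<^sup>2)
      \<le> (1 - a_dg p) * (err\<^sub>G s)\<^sup>2 + (noise_level \<sigma>\<^sub>G (L\<^sub>g * \<eta>))\<^sup>2 * \<epsilon> ^ 3 / c"
    unfolding s by (rule expectation_err_G_le)
  show "step_mean s (\<lambda>s. (err\<^sub>F s)\<^sup>2)
      \<le> (1 - a_Phi p) * (err\<^sub>F s)\<^sup>2 + (noise_level (K\<^sub>G * \<sigma>\<^sub>f) D\<^sub>F)\<^sup>2 * \<epsilon> ^ 3 / c"
    unfolding s by (rule expectation_err_F_le)
  show "3 / 4 * \<eta> * \<epsilon> * norm (snd (snd (snd s)))
      \<le> \<Phi> (fst s) - step_mean s (\<lambda>s. \<Phi> (fst s)) + 3 / 2 * \<eta> * \<epsilon>\<^sup>2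
        + \<eta> * \<epsilon> * norm (snd (snd (snd s)) - dPhi (fst s))"
    unfolding s using expected_descent by simp
qed

lemma init_law_eq:
  "law 0 = minibatch (S_g p) m \<bind> (\<lambda>sg. minibatch (S_dg p) m \<bind> (\<lambda>sdg. minibatch (S_f p) n \<bind> (\<lambda>sf.
     return_pmf (x0, sample_mean sg (\<lambda>j. g j x0), sample_mean sdg (\<lambda>j. jac (g j) x0),
       sample_mean sf (\<lambda>i. transpose (sample_mean sdg (\<lambda>j. jac (g j) x0))
         *v grad (f i) (sample_mean sg (\<lambda>j. g j x0)))))))"
  by (simp add: storm_init_def Let_def batch_avg_eq_sample_mean
      sample_mean_linear[OF matrix_vector_mul_linear])

lemma mean_init:
  "mean 0 h =
     measure_pmf.expectation (minibatch (S_g p) m) (\<lambda>sg.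
       measure_pmf.expectation (minibatch (S_dg p) m) (\<lambda>sdg.
         measure_pmf.expectation (minibatch (S_f p) n) (\<lambda>sf.
           h (x0, sample_mean sg (\<lambda>j. g j x0), sample_mean sdg (\<lambda>j. jac (g j) x0),
       sample_mean sf (\<lambda>i. transpose (sample_mean sdg (\<lambda>j. jac (g j) x0))
         *v grad (f i) (sample_mean sg (\<lambda>j. g j x0)))))))"
  unfolding init_law_eq
  by (simp add: expectation_bind_finite finite_minibatch[OF n] finite_minibatch[OF m])

lemma tame_law: "s \<in> set_pmf (law k) \<Longrightarrow> tame s"
proof (induction k arbitrary: s)
  case 0
  then obtain sg sdg where b: "sg \<in> set_pmf (minibatch (S_g p) m)" "sdg \<in> set_pmf (minibatch (S_dg p) m)"
    and fs: "fst s = x0" "fst (snd s) = sample_mean sg (\<lambda>j. g j x0)"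
      "fst (snd (snd s)) = sample_mean sdg (\<lambda>j. jac (g j) x0)"
    unfolding init_law_eq by auto
  have "err\<^sub>g s \<le> \<sigma>\<^sub>g"
    unfolding err\<^sub>g_def fs g_mean_def
    by (rule sample_mean_error_le[OF m batch_nonempty[OF S_lower(1) m b(1)] deviation_g])
  moreover have "err\<^sub>G s \<le> \<sigma>\<^sub>G"
    unfolding err\<^sub>G_def fs dg_mean_def
    by (rule sample_mean_error_le[OF m batch_nonempty[OF S_lower(2) m b(2)] deviation_dg])
  moreover have "\<sigma>\<^sub>g \<le> E\<^sub>g" "\<sigma>\<^sub>G \<le> E\<^sub>G"
    using pos c eta_pos by (simp_all add: E\<^sub>g_def E\<^sub>G_def)
  ultimately show ?case by (simp add: tame_def)
next
  case (Suc k)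
  then obtain s' where "s' \<in> set_pmf (law k)" "s \<in> set_pmf (storm_step f n g m \<eta> \<epsilon> p s')"
    by (simp only: state_law.simps set_bind_pmf UN_iff) blast
  then show ?case using tame_step_support Suc.IH by blast
qed

lemma mean_square_recursion:
  assumes "\<And>s. tame s \<Longrightarrow> step_mean s h \<le> (1 - a) * h s + D"
  shows "mean (Suc k) h \<le> (1 - a) * mean k h + D"
proof -
  have "mean (Suc k) h \<le> mean k (\<lambda>s. (1 - a) * h s + D)"
    unfolding mean_Suc
    using assms tame_law by (intro expectation_mono_on_support finite_law) auto
  also have "\<dots> = (1 - a) * mean k h + D"
    by (simp add: integrable_law)
  finally show ?thesis .
qed

lemma mean_square_init:
  "mean 0 (\<lambda>s. (err\<^sub>g s)\<^sup>2) \<le> \<sigma>\<^sub>g\<^sup>2 * \<epsilon> / c"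
  "mean 0 (\<lambda>s. (err\<^sub>G s)\<^sup>2) \<le> \<sigma>\<^sub>G\<^sup>2 * \<epsilon> / c"
  "mean 0 (\<lambda>s. (err\<^sub>F s)\<^sup>2) \<le> (K\<^sub>G * \<sigma>\<^sub>f)\<^sup>2 * \<epsilon> / c"
proof -
  have "mean 0 (\<lambda>s. (err\<^sub>g s)\<^sup>2) \<le> \<sigma>\<^sub>g\<^sup>2 / real (S_g p)"
    unfolding mean_init err\<^sub>g_def g_mean_def
    using expectation_sample_mean_error_le[OF m pos_of_lower_bound[OF S_lower(1)] deviation_g]
    by simp
  then show "mean 0 (\<lambda>s. (err\<^sub>g s)\<^sup>2) \<le> \<sigma>\<^sub>g\<^sup>2 * \<epsilon> / c"
    using sample_variance_le[OF S_lower(1)] by (rule order_trans)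
  have "mean 0 (\<lambda>s. (err\<^sub>G s)\<^sup>2) \<le> \<sigma>\<^sub>G\<^sup>2 / real (S_dg p)"
    unfolding mean_init err\<^sub>G_def dg_mean_def
    using expectation_sample_mean_error_le[OF m pos_of_lower_bound[OF S_lower(2)] deviation_dg]
    by simp
  then show "mean 0 (\<lambda>s. (err\<^sub>G s)\<^sup>2) \<le> \<sigma>\<^sub>G\<^sup>2 * \<epsilon> / c"
    using sample_variance_le[OF S_lower(2)] by (rule order_trans)
  have "mean 0 (\<lambda>s. (err\<^sub>F s)\<^sup>2) \<le> (K\<^sub>G * \<sigma>\<^sub>f)\<^sup>2 / real (S_f p)"
    unfolding mean_init
  proof (rule expectation_le_const[OF finite_minibatch[OF m]],
      rule expectation_le_const[OF finite_minibatch[OF m]])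
    fix sg sdg
    assume b: "sg \<in> set_pmf (minibatch (S_g p) m)" "sdg \<in> set_pmf (minibatch (S_dg p) m)"
    let ?G = "sample_mean sdg (\<lambda>j. jac (g j) x0)" and ?y = "sample_mean sg (\<lambda>j. g j x0)"
    have "norm (?G - dg_mean x0) \<le> \<sigma>\<^sub>G"
      unfolding dg_mean_def
      by (rule sample_mean_error_le[OF m batch_nonempty[OF S_lower(2) m b(2)] deviation_dg])
    also have "\<sigma>\<^sub>G \<le> E\<^sub>G" using pos c eta_pos by (simp add: E\<^sub>G_def)
    finally have G: "norm (?G - dg_mean x0) \<le> E\<^sub>G" .
    have "norm (transpose ?G *v grad (f i) ?y - index_mean n (\<lambda>i. transpose ?G *v grad (f i) ?y))
        \<le> K\<^sub>G * \<sigma>\<^sub>f" if i: "i \<in> {1..n}" for i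
      using transpose_deviation_le[OF G i] by (simp add: df_mean_transpose)
    from expectation_sample_mean_error_le[OF n pos_of_lower_bound[OF S_lower(3)] this]
    show "measure_pmf.expectation (minibatch (S_f p) n)
        (\<lambda>sf. (err\<^sub>F (x0, ?y, ?G, sample_mean sf (\<lambda>i. transpose ?G *v grad (f i) ?y)))\<^sup>2)
      \<le> (K\<^sub>G * \<sigma>\<^sub>f)\<^sup>2 / real (S_f p)"
      by (simp add: err\<^sub>F_def df_mean_transpose)
  qed
  then show "mean 0 (\<lambda>s. (err\<^sub>F s)\<^sup>2) \<le> (K\<^sub>G * \<sigma>\<^sub>f)\<^sup>2 * \<epsilon> / c"
    using sample_variance_le[OF S_lower(3)] by (rule order_trans)
qed

text \<open>
  The inequality \<open>h \<le> h\<^sup>2 / (2 * \<epsilon>) + \<epsilon> / 2\<close> turns a mean square of the order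
  \<open>\<epsilon>\<^sup>2\<close> into a mean of the order \<open>\<epsilon>\<close>. It is linear in the quantities that are
  summed and so takes the place of the inequalities of Jensen and Cauchy-Schwarz.
\<close>

lemma sum_mean_le_of_sum_mean_square_le:
  fixes h :: "('d::finite, 'l::finite) storm_state \<Rightarrow> real"
  assumes "(\<Sum>k<iters p. mean k (\<lambda>s. (h s)\<^sup>2)) \<le> real (iters p) * \<epsilon>\<^sup>2 * w"
  shows "(\<Sum>k<iters p. mean k h) \<le> real (iters p) * \<epsilon> * ((w + 1) / 2)"
proof -
  have "mean k h \<le> mean k (\<lambda>s. (h s)\<^sup>2) / (2 * \<epsilon>) + \<epsilon> / 2" for k
  proof -
    have "h s \<le> (h s)\<^sup>2 / (2 * \<epsilon>) + \<epsilon> / 2" for s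
    proof -
      have "0 \<le> (h s - \<epsilon>)\<^sup>2 / (2 * \<epsilon>)" using eps by simp
      then show ?thesis using eps by (simp add: power2_eq_square field_simps)
    qed
    then have "mean k h \<le> mean k (\<lambda>s. (h s)\<^sup>2 / (2 * \<epsilon>) + \<epsilon> / 2)"
      by (intro expectation_mono_on_support finite_law)
    then show ?thesis by (simp add: integrable_law)
  qed
  then have "(\<Sum>k<iters p. mean k h)
      \<le> (\<Sum>k<iters p. mean k (\<lambda>s. (h s)\<^sup>2) / (2 * \<epsilon>) + \<epsilon> / 2)"
    by (intro sum_mono)
  also have "\<dots> = (\<Sum>k<iters p. mean k (\<lambda>s. (h s)\<^sup>2)) / (2 * \<epsilon>) + real (iters p) * \<epsilon> / 2"
    by (simp add: sum.distrib sum_divide_distrib)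
  also have "\<dots> \<le> (real (iters p) * \<epsilon>\<^sup>2 * w) / (2 * \<epsilon>) + real (iters p) * \<epsilon> / 2"
    using assms eps by (intro add_right_mono divide_right_mono) auto
  also have "\<dots> = real (iters p) * \<epsilon> * ((w + 1) / 2)"
    using eps by (simp add: power2_eq_square field_simps)
  finally show ?thesis .
qed

lemma sum_mean_err_le:
  "(\<Sum>k<iters p. mean k err\<^sub>g)
     \<le> real (iters p) * \<epsilon> * ((mean_square_rate \<sigma>\<^sub>g \<sigma>\<^sub>g (M\<^sub>g * \<eta>) + 1) / 2)"
  "(\<Sum>k<iters p. mean k err\<^sub>G)
     \<le> real (iters p) * \<epsilon> * ((mean_square_rate \<sigma>\<^sub>G \<sigma>\<^sub>G (L\<^sub>g * \<eta>) + 1) / 2)"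
  "(\<Sum>k<iters p. mean k err\<^sub>F)
     \<le> real (iters p) * \<epsilon> * ((mean_square_rate (K\<^sub>G * \<sigma>\<^sub>f) (K\<^sub>G * \<sigma>\<^sub>f) D\<^sub>F + 1) / 2)"
proof -
  have nn: "mean k (\<lambda>s. (h s)\<^sup>2) \<ge> 0" for k and h :: "('d::finite, 'l::finite) storm_state \<Rightarrow> real"
    by (rule integral_nonneg_AE) simp
  show "(\<Sum>k<iters p. mean k err\<^sub>g)
     \<le> real (iters p) * \<epsilon> * ((mean_square_rate \<sigma>\<^sub>g \<sigma>\<^sub>g (M\<^sub>g * \<eta>) + 1) / 2)"
    by (intro sum_mean_le_of_sum_mean_square_le sum_mean_square_le[where a = "a_g p"]
        a_pos a_lower nn mean_square_init mean_square_recursion step_err_g)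
  show "(\<Sum>k<iters p. mean k err\<^sub>G)
     \<le> real (iters p) * \<epsilon> * ((mean_square_rate \<sigma>\<^sub>G \<sigma>\<^sub>G (L\<^sub>g * \<eta>) + 1) / 2)"
    by (intro sum_mean_le_of_sum_mean_square_le sum_mean_square_le[where a = "a_dg p"]
        a_pos a_lower nn mean_square_init mean_square_recursion step_err_G)
  show "(\<Sum>k<iters p. mean k err\<^sub>F)
     \<le> real (iters p) * \<epsilon> * ((mean_square_rate (K\<^sub>G * \<sigma>\<^sub>f) (K\<^sub>G * \<sigma>\<^sub>f) D\<^sub>F + 1) / 2)"
    by (intro sum_mean_le_of_sum_mean_square_le sum_mean_square_le[where a = "a_Phi p"]
        a_pos a_lower nn mean_square_init mean_square_recursion step_err_F)
qed

abbreviation gradient_error :: "('d::finite, 'l::finite) storm_state \<Rightarrow> real" where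
  "gradient_error s \<equiv> norm (snd (snd (snd s)) - dPhi (fst s))"

abbreviation direction_norm :: "('d::finite, 'l::finite) storm_state \<Rightarrow> real" where
  "direction_norm s \<equiv> norm (snd (snd (snd s)))"

lemma sum_mean_gradient_error_le:
  "(\<Sum>k<iters p. mean k gradient_error) \<le> real (iters p) * \<epsilon> * error_rate"
proof -
  have "mean k gradient_error \<le> mean k err\<^sub>F + M\<^sub>f * mean k err\<^sub>G + M\<^sub>g * L\<^sub>f * mean k err\<^sub>g" for k
  proof -
    have "mean k gradient_error
        \<le> mean k (\<lambda>s. err\<^sub>F s + M\<^sub>f * err\<^sub>G s + M\<^sub>g * L\<^sub>f * err\<^sub>g s)"
      using total_error_le by (intro expectation_mono_on_support finite_law)
    then show ?thesis by (simp add: integrable_law)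
  qed
  then have "(\<Sum>k<iters p. mean k gradient_error)
      \<le> (\<Sum>k<iters p. mean k err\<^sub>F + M\<^sub>f * mean k err\<^sub>G + M\<^sub>g * L\<^sub>f * mean k err\<^sub>g)"
    by (intro sum_mono)
  also have "\<dots> = (\<Sum>k<iters p. mean k err\<^sub>F) + M\<^sub>f * (\<Sum>k<iters p. mean k err\<^sub>G)
      + M\<^sub>g * L\<^sub>f * (\<Sum>k<iters p. mean k err\<^sub>g)"
    by (simp add: sum.distrib sum_distrib_left)
  also have "\<dots> \<le> real (iters p) * \<epsilon> * ((mean_square_rate (K\<^sub>G * \<sigma>\<^sub>f) (K\<^sub>G * \<sigma>\<^sub>f) D\<^sub>F + 1) / 2)
      + M\<^sub>f * (real (iters p) * \<epsilon> * ((mean_square_rate \<sigma>\<^sub>G \<sigma>\<^sub>G (L\<^sub>g * \<eta>) + 1) / 2))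
      + M\<^sub>g * L\<^sub>f * (real (iters p) * \<epsilon> * ((mean_square_rate \<sigma>\<^sub>g \<sigma>\<^sub>g (M\<^sub>g * \<eta>) + 1) / 2))"
    using sum_mean_err_le pos by (intro add_mono mult_left_mono) auto
  also have "\<dots> = real (iters p) * \<epsilon> * error_rate"
    by (simp add: error_rate_def algebra_simps)
  finally show ?thesis .
qed

text \<open>
  The expected decrease of \<open>\<Phi>\<close> telescopes and is bounded by the initial gap, which
  \<open>1 / \<epsilon>\<^sup>2\<close> iterations absorb. What remains per iteration is of the order
  \<open>\<epsilon>\<close>.
\<close>

lemma sum_mean_direction_norm_le:
  "(\<Sum>k<iters p. mean k direction_norm)
   \<le> real (iters p) * \<epsilon> * (4 / 3 * ((\<Phi> x0 - \<Phi>low) / (\<eta> * c)) + 2 + 4 / 3 * error_rate)"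
proof -
  define u where "u k = mean k (\<lambda>s. \<Phi> (fst s))" for k
  let ?T = "real (iters p)"
  have u0: "u 0 = \<Phi> x0" unfolding u_def mean_init by simp
  have u_ge: "u k \<ge> \<Phi>low" for k
  proof -
    have "mean k (\<lambda>_. \<Phi>low) \<le> u k"
      unfolding u_def using Phi_ge by (intro expectation_mono_on_support finite_law)
    then show ?thesis by simp
  qed
  have step: "3 / 4 * \<eta> * \<epsilon> * mean k direction_norm
      \<le> (u k - u (Suc k)) + 3 / 2 * \<eta> * \<epsilon>\<^sup>2 + \<eta> * \<epsilon> * mean k gradient_error" for k
  proof -
    have "mean k (\<lambda>s. 3 / 4 * \<eta> * \<epsilon> * direction_norm s)
        \<le> mean k (\<lambda>s. \<Phi> (fst s) - step_mean s (\<lambda>s. \<Phi> (fst s)) + 3 / 2 * \<eta> * \<epsilon>\<^sup>2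
          + \<eta> * \<epsilon> * gradient_error s)"
      by (rule expectation_mono_on_support[OF finite_law step_descent[OF tame_law]])
    then show ?thesis
      unfolding u_def mean_Suc by (simp add: integrable_law)
  qed
  have "3 / 4 * \<eta> * \<epsilon> * (\<Sum>k<iters p. mean k direction_norm)
      \<le> (\<Sum>k<iters p. (u k - u (Suc k)) + 3 / 2 * \<eta> * \<epsilon>\<^sup>2 + \<eta> * \<epsilon> * mean k gradient_error)"
    unfolding sum_distrib_left by (intro sum_mono step)
  also have "\<dots> = (u 0 - u (iters p)) + ?T * (3 / 2 * \<eta> * \<epsilon>\<^sup>2)
      + \<eta> * \<epsilon> * (\<Sum>k<iters p. mean k gradient_error)"
    by (simp add: sum.distrib sum_lessThan_telescope' sum_distrib_left)
  also have "\<dots> \<le> (\<Phi> x0 - \<Phi>low) + ?T * (3 / 2 * \<eta> * \<epsilon>\<^sup>2) + \<eta> * \<epsilon> * (?T * \<epsilon> * error_rate)"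
    using u0 u_ge[of "iters p"] eta_pos eps sum_mean_gradient_error_le
    by (intro add_mono mult_left_mono) auto
  also have "\<dots> \<le> (\<Phi> x0 - \<Phi>low) / c * (?T * \<epsilon>\<^sup>2) + ?T * (3 / 2 * \<eta> * \<epsilon>\<^sup>2)
      + \<eta> * \<epsilon> * (?T * \<epsilon> * error_rate)"
  proof -
    have "c \<le> ?T * \<epsilon>\<^sup>2" using T_lower eps by (simp add: divide_simps)
    then have "(\<Phi> x0 - \<Phi>low) / c * c \<le> (\<Phi> x0 - \<Phi>low) / c * (?T * \<epsilon>\<^sup>2)"
      using Phi_ge[of x0] c by (intro mult_left_mono) auto
    then show ?thesis using c by simp
  qed
  also have "\<dots> = 3 / 4 * \<eta> * \<epsilon> *
      (?T * \<epsilon> * (4 / 3 * ((\<Phi> x0 - \<Phi>low) / (\<eta> * c)) + 2 + 4 / 3 * error_rate))"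
    using eta_pos c by (simp add: field_simps power2_eq_square)
  finally show ?thesis
    by (rule mult_left_le_imp_le) (use eta_pos eps in simp)
qed

lemma expectation_output_le:
  "measure_pmf.expectation (storm_output f n g m x0 \<eta> \<epsilon> p) (\<lambda>x. norm (grad \<Phi> x))
   \<le> (4 / 3 * ((\<Phi> x0 - \<Phi>low) / (\<eta> * c)) + 2 + 7 / 3 * error_rate) * \<epsilon>"
proof -
  let ?T = "real (iters p)"
  have T: "?T > 0" using iters_pos by simp
  have "mean k (\<lambda>s. norm (dPhi (fst s))) \<le> mean k direction_norm + mean k gradient_error" for k
  proof -
    have "mean k (\<lambda>s. norm (dPhi (fst s))) \<le> mean k (\<lambda>s. direction_norm s + gradient_error s)"
      by (intro expectation_mono_on_support finite_law) (metis norm_minus_commute norm_triangle_sub)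
    then show ?thesis by (simp add: integrable_law)
  qed
  then have "(\<Sum>k<iters p. mean k (\<lambda>s. norm (dPhi (fst s))))
      \<le> (\<Sum>k<iters p. mean k direction_norm + mean k gradient_error)"
    by (intro sum_mono)
  also have "\<dots> \<le> ?T * ((4 / 3 * ((\<Phi> x0 - \<Phi>low) / (\<eta> * c)) + 2 + 7 / 3 * error_rate) * \<epsilon>)"
    using sum_mean_direction_norm_le sum_mean_gradient_error_le
    unfolding sum.distrib by (simp add: algebra_simps)
  finally show ?thesis
    unfolding grad_Phi expectation_storm_output[OF n m iters_pos]
    using T by (simp add: pos_divide_le_eq mult.commute)
qed

end

section \<open>Asymptotics\<close>

text \<open>
  Stating the two-sided bound for all large \<open>r\<close> lets finitely many rates share one constant.
\<close>

lemma eventually_bounds_of_bigtheta: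
  fixes h k :: "real \<Rightarrow> real"
  assumes theta: "h \<in> \<Theta>[F](k)" and h: "\<forall>\<^sub>F x in F. 0 \<le> h x" and k: "\<forall>\<^sub>F x in F. 0 < k x"
  shows "\<forall>\<^sub>F r in at_top. \<forall>\<^sub>F x in F. k x / r \<le> h x \<and> h x \<le> r * k x"
proof -
  obtain c1 where c1: "c1 > 0" "\<forall>\<^sub>F x in F. norm (h x) \<le> c1 * norm (k x)"
    using bigthetaD1[OF theta] by (elim landau_o.bigE)
  obtain c2 where c2: "c2 > 0" "\<forall>\<^sub>F x in F. norm (h x) \<ge> c2 * norm (k x)"
    using bigthetaD2[OF theta] by (elim landau_omega.bigE)
  have "\<forall>\<^sub>F x in F. k x / r \<le> h x \<and> h x \<le> r * k x" if r: "r \<ge> max c1 (1 / c2)" for r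
    using c1(2) c2(2) h k
  proof eventually_elim
    case (elim x)
    have "r > 0" using r c1(1) by simp
    then have "1 / r \<le> c2" using r c2(1) by (simp add: field_simps)
    then have "k x / r \<le> c2 * k x"
      using mult_right_mono[of "1 / r" c2 "k x"] elim by simp
    moreover have "c1 * k x \<le> r * k x" using r elim by (intro mult_right_mono) auto
    moreover have "h x \<le> c1 * k x" "c2 * k x \<le> h x" using elim by simp_all
    ultimately show ?case by linarith
  qed
  then show ?thesis unfolding eventually_at_top_linorder by blast
qed

theorem corollary3p1:
  fixes f :: "nat \<Rightarrow> real ^ 'l \<Rightarrow> real"
    and g :: "nat \<Rightarrow> real ^ 'd \<Rightarrow> real ^ 'l"
    and n m :: nat
    and \<Phi> :: "real ^ 'd \<Rightarrow> real"
    and x0 :: "real ^ 'd"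
    and L\<^sub>f L\<^sub>g L\<^sub>\<Phi> M\<^sub>f M\<^sub>g H\<^sub>1 H\<^sub>2 H\<^sub>3 :: real
    and p :: "real \<Rightarrow> storm_params"
  assumes n: "n \<ge> 1" and m: "m \<ge> 1"
    and Phi: "\<And>x. \<Phi> x = avg n f (avg m g x)"
    and f_diff: "\<And>i y. i \<in> {1..n} \<Longrightarrow> f i differentiable (at y)"
    and g_diff: "\<And>j x. j \<in> {1..m} \<Longrightarrow> g j differentiable (at x)"
    and finite_gap: "ereal (\<Phi> x0) - (INF x. ereal (\<Phi> x)) < \<infinity>"
    and pos: "L\<^sub>f > 0" "L\<^sub>g > 0" "L\<^sub>\<Phi> > 0" "M\<^sub>f > 0" "M\<^sub>g > 0" "H\<^sub>1 > 0" "H\<^sub>2 > 0" "H\<^sub>3 > 0"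
    and smooth_g: "\<And>j x x'. j \<in> {1..m} \<Longrightarrow>
          norm (jac (g j) x - jac (g j) x') \<le> L\<^sub>g * norm (x - x')"
    and smooth_f: "\<And>i y y'. i \<in> {1..n} \<Longrightarrow>
          norm (grad (f i) y - grad (f i) y') \<le> L\<^sub>f * norm (y - y')"
    and smooth_Phi: "\<And>i j x x'. i \<in> {1..n} \<Longrightarrow> j \<in> {1..m} \<Longrightarrow>
          norm (transpose (jac (g j) x) *v grad (f i) (avg m g x)
                - transpose (jac (g j) x') *v grad (f i) (avg m g x')) \<le> L\<^sub>\<Phi> * norm (x - x')"
    and bound_g: "\<And>j x. j \<in> {1..m} \<Longrightarrow> onorm ((*v) (jac (g j) x)) \<le> M\<^sub>g"
    and bound_f: "\<And>i y. i \<in> {1..n} \<Longrightarrow> norm (grad (f i) y) \<le> M\<^sub>f"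
    and L_Phi: "L\<^sub>\<Phi> = M\<^sub>f * L\<^sub>g + M\<^sub>g\<^sup>2 * L\<^sub>f"
    and var_f: "\<And>y. measure_pmf.expectation (uniform_index n)
          (\<lambda>i. (norm (grad (f i) y - grad (avg n f) y))\<^sup>2) \<le> H\<^sub>1"
    and var_dg: "\<And>x. measure_pmf.expectation (uniform_index m)
          (\<lambda>j. (norm (jac (g j) x - jac (avg m g) x))\<^sup>2) \<le> H\<^sub>2"
    and var_g: "\<And>x. measure_pmf.expectation (uniform_index m)
          (\<lambda>j. (norm (g j x - avg m g x))\<^sup>2) \<le> H\<^sub>3"
    and admissible: "\<forall>\<^sub>F \<epsilon> in at_right 0.
          a_g (p \<epsilon>) \<in> {0<..<1} \<and> a_dg (p \<epsilon>) \<in> {0<..<1} \<and> a_Phi (p \<epsilon>) \<in> {0<..<1} \<and>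
          B_g (p \<epsilon>) > 0 \<and> B_dg (p \<epsilon>) > 0 \<and> B_f (p \<epsilon>) > 0 \<and>
          S_g (p \<epsilon>) > 0 \<and> S_dg (p \<epsilon>) > 0 \<and> S_f (p \<epsilon>) > 0 \<and> iters (p \<epsilon>) > 0"
    and momentum: "(\<lambda>\<epsilon>. a_g (p \<epsilon>)) \<in> \<Theta>[at_right 0](\<lambda>\<epsilon>. \<epsilon>)"
          "(\<lambda>\<epsilon>. a_dg (p \<epsilon>)) \<in> \<Theta>[at_right 0](\<lambda>\<epsilon>. \<epsilon>)"
          "(\<lambda>\<epsilon>. a_Phi (p \<epsilon>)) \<in> \<Theta>[at_right 0](\<lambda>\<epsilon>. \<epsilon>)"
    and batches: "(\<lambda>\<epsilon>. real (B_g (p \<epsilon>))) \<in> \<Theta>[at_right 0](\<lambda>\<epsilon>. 1 / \<epsilon>)"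
          "(\<lambda>\<epsilon>. real (B_dg (p \<epsilon>))) \<in> \<Theta>[at_right 0](\<lambda>\<epsilon>. 1 / \<epsilon>)"
          "(\<lambda>\<epsilon>. real (B_f (p \<epsilon>))) \<in> \<Theta>[at_right 0](\<lambda>\<epsilon>. 1 / \<epsilon>)"
          "(\<lambda>\<epsilon>. real (S_g (p \<epsilon>))) \<in> \<Theta>[at_right 0](\<lambda>\<epsilon>. 1 / \<epsilon>)"
          "(\<lambda>\<epsilon>. real (S_dg (p \<epsilon>))) \<in> \<Theta>[at_right 0](\<lambda>\<epsilon>. 1 / \<epsilon>)"
          "(\<lambda>\<epsilon>. real (S_f (p \<epsilon>))) \<in> \<Theta>[at_right 0](\<lambda>\<epsilon>. 1 / \<epsilon>)"
    and iterations: "(\<lambda>\<epsilon>. real (iters (p \<epsilon>))) \<in> \<Theta>[at_right 0](\<lambda>\<epsilon>. 1 / \<epsilon>\<^sup>2)"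
  shows "(\<lambda>\<epsilon>. measure_pmf.expectation (storm_output f n g m x0 (1 / L\<^sub>\<Phi>) \<epsilon> (p \<epsilon>))
            (\<lambda>x. norm (grad \<Phi> x))) \<in> O[at_right 0](\<lambda>\<epsilon>. \<epsilon>)
    \<and> (\<lambda>\<epsilon>. real (storm_IFO (p \<epsilon>))) \<in> O[at_right 0](\<lambda>\<epsilon>. 1 / \<epsilon> ^ 3)"
proof -
  have eps_pos: "\<forall>\<^sub>F \<epsilon> in at_right (0::real). 0 < \<epsilon>"
    by (rule eventually_at_right_less)
  have inv_pos: "\<forall>\<^sub>F \<epsilon> in at_right (0::real). 0 < 1 / \<epsilon>" "\<forall>\<^sub>F \<epsilon> in at_right (0::real). 0 < 1 / \<epsilon>\<^sup>2"
    using eps_pos by (eventually_elim, simp)+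
  have a_nonneg: "\<forall>\<^sub>F \<epsilon> in at_right 0. 0 \<le> a_g (p \<epsilon>)" "\<forall>\<^sub>F \<epsilon> in at_right 0. 0 \<le> a_dg (p \<epsilon>)"
    "\<forall>\<^sub>F \<epsilon> in at_right 0. 0 \<le> a_Phi (p \<epsilon>)"
    using admissible by (eventually_elim, simp)+
  define between where "between r l v u \<longleftrightarrow> l / r \<le> v \<and> v \<le> r * u" for r l v u :: real
  note bounds = eventually_bounds_of_bigtheta[folded between_def]
  have "\<forall>\<^sub>F r in at_top. r > 0 \<and> (\<forall>\<^sub>F \<epsilon> in at_right 0.
      between r \<epsilon> (a_g (p \<epsilon>)) \<epsilon> \<and> between r \<epsilon> (a_dg (p \<epsilon>)) \<epsilon> \<and> between r \<epsilon> (a_Phi (p \<epsilon>)) \<epsilon> \<and>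
      between r (1 / \<epsilon>) (B_g (p \<epsilon>)) (1 / \<epsilon>) \<and> between r (1 / \<epsilon>) (B_dg (p \<epsilon>)) (1 / \<epsilon>) \<and>
      between r (1 / \<epsilon>) (B_f (p \<epsilon>)) (1 / \<epsilon>) \<and> between r (1 / \<epsilon>) (S_g (p \<epsilon>)) (1 / \<epsilon>) \<and>
      between r (1 / \<epsilon>) (S_dg (p \<epsilon>)) (1 / \<epsilon>) \<and> between r (1 / \<epsilon>) (S_f (p \<epsilon>)) (1 / \<epsilon>) \<and>
      between r (1 / \<epsilon>\<^sup>2) (iters (p \<epsilon>)) (1 / \<epsilon>\<^sup>2))"
    unfolding eventually_conj_iff
    by (intro conjI eventually_gt_at_top bounds momentum batches iterations eps_pos inv_pos a_nonneg)
       (simp_all add: always_eventually)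
  then obtain r where r: "r > 0" and within: "\<forall>\<^sub>F \<epsilon> in at_right 0.
      between r \<epsilon> (a_g (p \<epsilon>)) \<epsilon> \<and> between r \<epsilon> (a_dg (p \<epsilon>)) \<epsilon> \<and> between r \<epsilon> (a_Phi (p \<epsilon>)) \<epsilon> \<and>
      between r (1 / \<epsilon>) (B_g (p \<epsilon>)) (1 / \<epsilon>) \<and> between r (1 / \<epsilon>) (B_dg (p \<epsilon>)) (1 / \<epsilon>) \<and>
      between r (1 / \<epsilon>) (B_f (p \<epsilon>)) (1 / \<epsilon>) \<and> between r (1 / \<epsilon>) (S_g (p \<epsilon>)) (1 / \<epsilon>) \<and>
      between r (1 / \<epsilon>) (S_dg (p \<epsilon>)) (1 / \<epsilon>) \<and> between r (1 / \<epsilon>) (S_f (p \<epsilon>)) (1 / \<epsilon>) \<and>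
      between r (1 / \<epsilon>\<^sup>2) (iters (p \<epsilon>)) (1 / \<epsilon>\<^sup>2)"
    using eventually_happens[of _ "at_top :: real filter"] by (metis (no_types, lifting) trivial_limit_at_top_linorder)
  obtain \<Phi>low where low: "\<And>x. \<Phi>low \<le> \<Phi> x"
  proof -
    obtain I where I: "I = (INF x. ereal (\<Phi> x))" by blast
    have "I \<noteq> -\<infinity>" using finite_gap unfolding I by auto
    moreover have "I \<le> ereal (\<Phi> x)" for x unfolding I by (rule INF_lower) simp
    ultimately have "real_of_ereal I \<le> \<Phi> x" for x
      by (metis PInfty_neq_ereal(1) ereal_infty_less_eq(1) ereal_less_eq(3) real_of_ereal.elims
          real_of_ereal.simps(1))
    then show ?thesis by (rule that)
  qed
  interpret rate_constants f g n m \<Phi> \<Phi>low L\<^sub>f L\<^sub>g L\<^sub>\<Phi> M\<^sub>f M\<^sub>g H\<^sub>1 H\<^sub>2 H\<^sub>3 "1 / r" r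
    using assms low r by unfold_locales auto
  define K where "K = 4 / 3 * ((\<Phi> x0 - \<Phi>low) / (\<eta> * (1 / r))) + 2 + 7 / 3 * error_rate"
  have "\<forall>\<^sub>F \<epsilon> in at_right 0. norm (measure_pmf.expectation
      (storm_output f n g m x0 (1 / L\<^sub>\<Phi>) \<epsilon> (p \<epsilon>)) (\<lambda>x. norm (grad \<Phi> x))) \<le> K * norm \<epsilon>"
    using eps_pos admissible within
  proof eventually_elim
    case (elim \<epsilon>)
    interpret calibrated_run f g n m \<Phi> \<Phi>low L\<^sub>f L\<^sub>g L\<^sub>\<Phi> M\<^sub>f M\<^sub>g H\<^sub>1 H\<^sub>2 H\<^sub>3 "1 / r" r \<epsilon> "p \<epsilon>" x0
      using elim r by unfold_locales (auto simp: between_def mult.commute)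
    have "0 \<le> measure_pmf.expectation
        (storm_output f n g m x0 \<eta> \<epsilon> (p \<epsilon>)) (\<lambda>x. norm (grad \<Phi> x))"
      by (rule integral_nonneg_AE) simp
    then show ?case
      using expectation_output_le elim(1) by (simp add: K_def \<eta>_def)
  qed
  then have "(\<lambda>\<epsilon>. measure_pmf.expectation (storm_output f n g m x0 (1 / L\<^sub>\<Phi>) \<epsilon> (p \<epsilon>))
            (\<lambda>x. norm (grad \<Phi> x))) \<in> O[at_right 0](\<lambda>\<epsilon>. \<epsilon>)"
    by (rule bigoI)
  moreover have "(\<lambda>\<epsilon>. real (storm_IFO (p \<epsilon>))) \<in> O[at_right 0](\<lambda>\<epsilon>. 1 / \<epsilon> ^ 3)"
  proof -
    have lt1: "\<forall>\<^sub>F \<epsilon> in at_right (0::real). \<epsilon> < 1"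
      by (rule eventually_at_right_real[of 0 1, THEN eventually_mono]) auto
    have "\<forall>\<^sub>F \<epsilon> in at_right 0. norm (real (storm_IFO (p \<epsilon>))) \<le> (3 * r + 3 * r\<^sup>2) * norm (1 / \<epsilon> ^ 3)"
      using eps_pos lt1 within
    proof eventually_elim
      case (elim \<epsilon>)
      have "real (storm_IFO (p \<epsilon>)) = (real (S_g (p \<epsilon>)) + S_dg (p \<epsilon>) + S_f (p \<epsilon>))
          + real (iters (p \<epsilon>)) * (real (B_g (p \<epsilon>)) + B_dg (p \<epsilon>) + B_f (p \<epsilon>))"
        by (simp add: storm_IFO_def)
      also have "\<dots> \<le> 3 * (r * (1 / \<epsilon>)) + (r * (1 / \<epsilon>\<^sup>2)) * (3 * (r * (1 / \<epsilon>)))"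
        using elim r unfolding between_def by (intro add_mono mult_mono) auto
      also have "\<dots> = 3 * r * (1 / \<epsilon>) + 3 * r\<^sup>2 * (1 / \<epsilon> ^ 3)"
        by (simp add: power2_eq_square power3_eq_cube)
      also have "\<dots> \<le> 3 * r * (1 / \<epsilon> ^ 3) + 3 * r\<^sup>2 * (1 / \<epsilon> ^ 3)"
        using elim r power_decreasing[of 1 3 \<epsilon>]
        by (intro add_right_mono mult_left_mono divide_left_mono) auto
      finally show ?case using elim by (simp add: add_divide_distrib)
    qed
    then show ?thesis by (rule bigoI)
  qed
  ultimately show ?thesis ..
qed

end
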